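(* For every fixed prime power $q$, there is a constant $C_q$ (depending only on $q$) such that $$\left\lfloor\frac{n-1}{q-1}\right\rfloor \leq D_q(n) \leq \left\lceil\frac{n}{q-1}\right\rceil + C_q - 1$$ for every integer $n\geq 1$. In particular, $$D_q(n)=\frac{n}{q-1}+O_q(1) \qquad\text{and hence}\qquad D_q(n)\sim\frac{n}{q-1}\quad (n\to\infty).$$
   Context: Let $q$ be a prime power and $\mathbb{F}_q[x]$ the univariate polynomial ring over the finite field $\mathbb{F}_q$. Convention: $\deg 0=-\infty$. A congruence class is a set $r \pmod f := \{g\in\mathbb{F}_q[x] : g\equiv r \pmod f\}$, where $r,f\in\mathbb{F}_q[x]$ and $f$ is nonconstant (i.e. a coset of the ideal $(f)$). A finite family of congruence classes is non-covering if its union is not all of $\mathbb{F}_q[x]$. For $n\geq 1$ define $$D_q(n):=\max_{\substack{\mathcal{C}\text{ is a non-covering family}\\ |\mathcal{C}|=n}}\ \min\Bigl\{\deg g : g\in\mathbb{F}_q[x],\ g\notin\bigcup\mathcal{C}\Bigr\},$$ where $\bigcup\mathcal{C}$ denotes the union of the classes in $\mathcal{C}$. The notation $O_q(1)$ denotes a quantity bounded in absolute value by a constant depending only on $q$. *)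

theory Defs
  imports
    "HOL-Number_Theory.Cong"
    "HOL-Computational_Algebra.Polynomial"
    "HOL-Library.Cardinality"
    "HOL-Library.Extended_Real"
    "HOL-Library.Landau_Symbols"
begin

text \<open>
  The library's \<^const>\<open>degree\<close> sends \<open>0\<close> to \<open>0\<close>; here \<open>deg 0 = -\<infinity>\<close>, so degrees live in
  \<^typ>\<open>ereal\<close>.
\<close>
definition deg :: "'a::zero poly \<Rightarrow> ereal" where
  "deg g = (if g = 0 then -\<infinity> else ereal (real (degree g)))"

definition congruence_class :: "'a::field poly \<Rightarrow> 'a poly \<Rightarrow> 'a poly set" where
  "congruence_class r f = {g. [g = r] (mod f)}"

definition is_congruence_class :: "'a::field poly set \<Rightarrow> bool" where
  "is_congruence_class A \<longleftrightarrow> (\<exists>r f. degree f > 0 \<and> A = congruence_class r f)"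

definition non_covering_families :: "nat \<Rightarrow> 'a::field poly set set set" where
  "non_covering_families n =
     {C. finite C \<and> card C = n \<and> (\<forall>A\<in>C. is_congruence_class A) \<and> \<Union>C \<noteq> UNIV}"

definition min_uncovered_deg :: "'a::field poly set set \<Rightarrow> ereal" where
  "min_uncovered_deg C = (LEAST d. \<exists>g. g \<notin> \<Union>C \<and> d = deg g)"

text \<open>
  The least element exists even though the order on \<^typ>\<open>ereal\<close> is not a well-order.
\<close>
lemma min_uncovered_deg:
  assumes "\<Union>C \<noteq> UNIV"
  shows "\<exists>g. g \<notin> \<Union>C \<and> min_uncovered_deg C = deg g"
    and "g \<notin> \<Union>C \<Longrightarrow> min_uncovered_deg C \<le> deg g"
proof -
  let ?m = "\<lambda>g :: 'a poly. if g = 0 then 0 else Suc (degree g)"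
  have mono: "deg g \<le> deg h" if "?m g \<le> ?m h" for g h :: "'a poly"
    using that by (auto simp: deg_def split: if_splits)
  obtain g0 where "g0 \<notin> \<Union>C"
    using assms by blast
  then obtain g1 where g1: "g1 \<notin> \<Union>C" "\<And>h. h \<notin> \<Union>C \<Longrightarrow> ?m g1 \<le> ?m h"
    using ex_has_least_nat[of "\<lambda>g. g \<notin> \<Union>C" g0 ?m] by blast
  have eq: "min_uncovered_deg C = deg g1"
    unfolding min_uncovered_deg_def
    by (rule Least_equality) (use g1 mono in blast)+
  show "\<exists>g. g \<notin> \<Union>C \<and> min_uncovered_deg C = deg g"
    using g1(1) eq by blast
  show "min_uncovered_deg C \<le> deg g" if "g \<notin> \<Union>C"
    using g1(2)[OF that] mono eq by metis
qed

text \<open>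
  The values over which the maximum is taken. There are infinitely many families of size \<open>n\<close>,
  so the maximum is meaningful only once this set is known to be finite.
\<close>
definition Dq_values :: "'a::field itself \<Rightarrow> nat \<Rightarrow> ereal set" where
  "Dq_values F n = min_uncovered_deg ` (non_covering_families n :: 'a poly set set set)"

definition Dq :: "'a::field itself \<Rightarrow> nat \<Rightarrow> ereal" where
  "Dq F n = Max (Dq_values F n)"

end

theory Submission
  imports Defs "HOL-Computational_Algebra.Polynomial_Factorial"
begin

text \<open>
  Lower bound. The \<open>q - 1\<close> classes \<open>a x^i mod x^(i+1)\<close> with \<open>a \<noteq> 0\<close> cover exactly the polynomials of
  \<open>x\<close>-adic valuation \<open>i\<close>. Taking them for all \<open>i < m\<close>, together with classes \<open>0 mod x^k\<close> for \<open>k > m\<close>, covers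
  all polynomials of degree below \<open>m\<close> but misses \<open>x^m\<close> (\<open>ex_family_covering_below\<close>).

  Upper bound. It suffices to find an uncovered polynomial of degree at most \<open>(n + O(1)) / (q - 1)\<close>.
  The argument has two parts.

  The first part (\<open>uncovered_reduces_to_residue_avoidance\<close>) starts from any uncovered \<open>g0\<close>, possibly of huge
  degree, and shrinks the problem to residues modulo distinct primes. Each class may be enlarged to a
  class modulo a prime power that still misses \<open>g0\<close>. For a fixed prime \<open>p\<close> these classes branch off the
  path of \<open>g0\<close> in the tree of residues modulo powers of \<open>p\<close>. As long as all \<open>|p| - 1\<close> other branches may
  be blocked, one has to follow \<open>g0\<close>, but each such step uses up \<open>|p| - 1 \<ge> (q - 1) degree p\<close> classes and so
  pays for the \<open>degree p\<close> which it adds to the modulus. At the first level where fewer classes branch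
  off, there is a free branch other than the one of \<open>g0\<close>, and entering it avoids all deeper classes as
  well. What remains is to choose a polynomial \<open>u\<close> that avoids, for finitely many primes \<open>p\<close>, fewer than
  \<open>|p|\<close> residues modulo \<open>p\<close>, in total at most as many residues as there are classes left.

  The second part (\<open>ex_avoiding_below_sum_of_residues\<close>) is a sieve: \<open>m\<close> such residues can be avoided in
  degree \<open>m / (q - 1) + O(1)\<close>. The Chinese remainder theorem alone would cost \<open>degree p\<close> for every prime,
  which is too much when few residues are removed modulo many primes of degree about \<open>log m\<close>. It is
  therefore used only for primes of small degree and for primes with many removed residues. For the
  other primes, the sum of \<open>(removed residues) / |p|\<close> is bounded in terms of \<open>q\<close>, and truncated inclusion-exclusion of
  bounded order (\<open>avoiding_density_approx\<close>) shows that a positive proportion of all polynomials survives.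
\<close>

section \<open>Polynomials of bounded degree and prime polynomials\<close>

text \<open>
  The space of polynomials of degree below \<open>e\<close>. Phrased through coefficients, it is visibly a linear
  space and needs no special case for \<open>0\<close>, whose degree is \<open>0\<close> by convention.
\<close>
definition polys_below :: "nat \<Rightarrow> 'a::zero poly set" where
  "polys_below e = {h. \<forall>i\<ge>e. coeff h i = 0}"

lemma polys_below_iff: "h \<in> polys_below e \<longleftrightarrow> h = 0 \<or> degree h < e"
proof
  assume "h \<in> polys_below e"
  then show "h = 0 \<or> degree h < e"
    unfolding polys_below_def by (metis (mono_tags) leading_coeff_0_iff mem_Collect_eq not_le)
qed (auto simp: polys_below_def coeff_eq_0)

lemma polys_below_0 [simp]: "0 \<in> polys_below e"
  by (simp add: polys_below_def)

lemma polys_below_add: "f \<in> polys_below e \<Longrightarrow> g \<in> polys_below e \<Longrightarrow> f + g \<in> polys_below e"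
  for f g :: "'a::comm_monoid_add poly"
  by (simp add: polys_below_def)

lemma polys_below_diff: "f \<in> polys_below e \<Longrightarrow> g \<in> polys_below e \<Longrightarrow> f - g \<in> polys_below e"
  for f g :: "'a::ab_group_add poly"
  by (simp add: polys_below_def)

lemma polys_below_mono: "d \<le> e \<Longrightarrow> polys_below d \<subseteq> polys_below e"
  by (auto simp: polys_below_def)

lemma mod_in_polys_below: "f mod p \<in> polys_below (degree p)" if "p \<noteq> 0"
  for p :: "'a::field poly"
  using that degree_mod_less[of p f] by (auto simp: polys_below_iff)

lemma mult_in_polys_below_iff:
  "p * h \<in> polys_below (degree p + e) \<longleftrightarrow> h \<in> polys_below e" if "p \<noteq> 0"
  for p :: "'a::idom poly"
  using that by (cases "h = 0") (auto simp: polys_below_iff degree_mult_eq)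

lemma dvd_in_polys_below_eq_0: "p dvd h \<Longrightarrow> h \<in> polys_below (degree p) \<Longrightarrow> h = 0"
  for p :: "'a::idom poly"
  by (metis dvd_imp_degree_le linorder_not_less polys_below_iff)

lemma finite_card_polys_below:
  "finite (polys_below e :: 'a::{finite,field} poly set) \<and>
   card (polys_below e :: 'a poly set) = CARD('a) ^ e"
proof (induction e)
  case 0
  have "(polys_below 0 :: 'a poly set) = {0}"
    by (auto simp: polys_below_iff)
  then show ?case by simp
next
  case (Suc e)
  let ?f = "\<lambda>(a, h). pCons a h :: 'a poly"
  have "polys_below (Suc e) = ?f ` (UNIV \<times> polys_below e)"
  proof (intro equalityI subsetI)
    fix h :: "'a poly" assume h: "h \<in> polys_below (Suc e)"
    obtain a g where hg: "h = pCons a g" by (cases h)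
    have "g \<in> polys_below e"
      using h unfolding hg polys_below_def by (auto simp: coeff_pCons split: nat.splits)
    then show "h \<in> ?f ` (UNIV \<times> polys_below e)"
      using hg by auto
  qed (auto simp: polys_below_def coeff_pCons split: nat.splits)
  moreover have "inj_on ?f (UNIV \<times> polys_below e)"
    by (auto simp: inj_on_def)
  ultimately show ?case
    using Suc by (simp add: card_image card_cartesian_product)
qed

lemma finite_polys_below [simp]: "finite (polys_below e :: 'a::{finite,field} poly set)"
  and card_polys_below: "card (polys_below e :: 'a poly set) = CARD('a) ^ e"
  using finite_card_polys_below by blast+

lemma card_field_ge_2: "2 \<le> CARD('a::{finite,field})"
proof -
  have "card {0, 1::'a} \<le> CARD('a)"
    by (intro card_mono) auto
  then show ?thesis by simp
qed

text \<open>
  Monic irreducible polynomials (called primes below, with \<open>|p| = q ^ degree p\<close>) represent each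
  associate class once, so that distinct ones are coprime.
\<close>
definition monic_irreducible :: "'a::field poly \<Rightarrow> bool" where
  "monic_irreducible p \<longleftrightarrow> irreducible p \<and> lead_coeff p = 1"

lemma monic_irreducible_nonzero: "monic_irreducible p \<Longrightarrow> p \<noteq> 0"
  by (auto simp: monic_irreducible_def)

lemma monic_irreducible_prime_elem: "monic_irreducible p \<Longrightarrow> prime_elem p"
  by (simp add: monic_irreducible_def field_poly_irreducible_imp_prime)

lemma monic_irreducible_degree_pos: "monic_irreducible p \<Longrightarrow> 0 < degree p"
  by (metis irreducible_def is_unit_iff_degree monic_irreducible_def neq0_conv)

lemma monic_irreducible_dvd_mult_iff:
  "monic_irreducible p \<Longrightarrow> p dvd f * g \<longleftrightarrow> p dvd f \<or> p dvd g"
  using monic_irreducible_prime_elem prime_elem_dvd_mult_iff by blast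

lemma monic_irreducible_dvd_eq:
  assumes "monic_irreducible p" "monic_irreducible p'" "p dvd p'"
  shows "p = p'"
proof -
  obtain c where c: "p' = p * c" using assms(3) by blast
  have "is_unit c"
    using assms c by (metis irreducible_def monic_irreducible_def)
  then obtain a where a: "c = [:a:]"
    by (metis is_unit_poly_iff)
  have "lead_coeff p' = lead_coeff p * a"
    using c a by (metis lead_coeff_mult lead_coeff_pCons(2))
  then have "a = 1"
    using assms by (simp add: monic_irreducible_def)
  then show ?thesis using c a by (simp add: one_poly_def)
qed

lemma monic_irreducible_dvd_power:
  "monic_irreducible p \<Longrightarrow> monic_irreducible p' \<Longrightarrow> p dvd p' ^ k \<Longrightarrow> p = p'"
  using monic_irreducible_dvd_eq monic_irreducible_prime_elem prime_elem_dvd_power by blast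

lemma monic_irreducible_dvd_prod:
  assumes "monic_irreducible p" "finite S" "p dvd (\<Prod>x\<in>S. f x)"
  shows "\<exists>x\<in>S. p dvd f x"
  using assms(2,3)
proof (induction S rule: finite_induct)
  case empty
  then show ?case
    using assms(1) monic_irreducible_prime_elem prime_elem_not_unit by auto
qed (use assms(1) in \<open>auto simp: monic_irreducible_dvd_mult_iff\<close>)

lemma ex_monic_irreducible_dvd:
  fixes f :: "'a::field poly"
  assumes "degree f > 0"
  shows "\<exists>p. monic_irreducible p \<and> p dvd f"
proof -
  define P where "P = (\<lambda>p. p dvd f \<and> degree p > 0)"
  obtain p where p: "P p" "\<And>r. P r \<Longrightarrow> degree p \<le> degree r"
    using ex_has_least_nat[of P f degree] assms by (auto simp: P_def)
  have p0: "p \<noteq> 0" "degree p > 0" "p dvd f" using p(1) by (auto simp: P_def)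
  have irr: "irreducible p"
  proof (rule irreducibleI)
    show "\<not> is_unit p" using p0 by (simp add: is_unit_iff_degree)
    fix a b assume ab: "p = a * b"
    then have ne: "a \<noteq> 0" "b \<noteq> 0" using p0 by auto
    have "a dvd f" "b dvd f" using ab p0(3) by (metis dvd_mult_left, metis dvd_mult_right)
    then have "degree a = 0 \<or> degree p \<le> degree a" "degree b = 0 \<or> degree p \<le> degree b"
      using p(2)[of a] p(2)[of b] by (auto simp: P_def)
    moreover have "degree p = degree a + degree b" using ab ne by (simp add: degree_mult_eq)
    ultimately have "degree a = 0 \<or> degree b = 0" by linarith
    then show "is_unit a \<or> is_unit b"
      using ne by (simp add: is_unit_iff_degree)
  qed (use p0 in auto)
  let ?c = "inverse (lead_coeff p)"
  have "?c \<noteq> 0" using p0 by simp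
  have "is_unit [:?c:]"
    using \<open>?c \<noteq> 0\<close> by (simp add: is_unit_const_poly_iff dvd_field_iff)
  then have "irreducible (smult ?c p)"
    using irr irreducible_mult_unit_left[of "[:?c:]" p] by simp
  then have "monic_irreducible (smult ?c p)"
    using p0 by (simp add: monic_irreducible_def)
  moreover have "smult ?c p dvd f"
    using p0 \<open>?c \<noteq> 0\<close> by (metis smult_dvd_iff)
  ultimately show ?thesis by blast
qed

text \<open>
  If \<open>f\<close> does not divide \<open>d\<close>, some prime has a higher exponent in \<open>f\<close> than in \<open>d\<close>. Applied to
  \<open>d = g0 - r\<close> this names a prime power modulo which \<open>g0\<close> already leaves the class \<open>r mod f\<close>.
\<close>
lemma ex_prime_power_separating:
  fixes f d :: "'a::field poly"
  assumes "f \<noteq> 0" "\<not> f dvd d"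
  shows "\<exists>p i. monic_irreducible p \<and> p ^ i dvd d \<and> \<not> p ^ Suc i dvd d \<and> p ^ Suc i dvd f"
proof -
  have "\<exists>p i. monic_irreducible p \<and> \<not> p ^ i dvd d \<and> p ^ i dvd f"
    using assms
  proof (induction "degree f" arbitrary: f d rule: less_induct)
    case less
    have "\<not> is_unit f" using less.prems unit_imp_dvd by blast
    then have "degree f > 0" using less.prems is_unit_iff_degree by blast
    then obtain p where p: "monic_irreducible p" "p dvd f"
      using ex_monic_irreducible_dvd by blast
    show ?case
    proof (cases "p dvd d")
      case False
      then show ?thesis using p by (intro exI[of _ p] exI[of _ 1]) simp
    next
      case True
      obtain f' d' where fd: "f = p * f'" "d = p * d'" using p True by blast
      have p0: "p \<noteq> 0" "degree p > 0"
        using p monic_irreducible_nonzero monic_irreducible_degree_pos by auto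
      have f': "f' \<noteq> 0" "\<not> f' dvd d'" using fd less.prems by auto
      have "degree f' < degree f" using fd f' p0 by (simp add: degree_mult_eq)
      then obtain p' i where p': "monic_irreducible p'" "\<not> p' ^ i dvd d'" "p' ^ i dvd f'"
        using less.hyps f' by blast
      show ?thesis
      proof (cases "p' = p")
        case True
        then show ?thesis
          using p' fd p0 by (intro exI[of _ p] exI[of _ "Suc i"]) auto
      next
        case False
        have "\<not> p' dvd p" using False p p' monic_irreducible_dvd_eq by blast
        then have "\<not> p' ^ i dvd d"
          using p'(1,2) fd prime_elem_power_dvd_cases[of p' i p d' 1 i] monic_irreducible_prime_elem
          by auto
        then show ?thesis using p' fd by (intro exI[of _ p'] exI[of _ i]) auto
      qed
    qed
  qed
  then obtain p i where pi: "monic_irreducible p" "\<not> p ^ i dvd d" "p ^ i dvd f" by blast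
  define j where "j = (LEAST j. \<not> p ^ j dvd d)"
  have j: "\<not> p ^ j dvd d" "j \<le> i" 
    unfolding j_def using LeastI[of "\<lambda>j. \<not> p ^ j dvd d" i] Least_le[of "\<lambda>j. \<not> p ^ j dvd d" i] pi by auto
  then obtain k where k: "j = Suc k" by (cases j) auto
  have "p ^ k dvd d" using k not_less_Least[of k "\<lambda>j. \<not> p ^ j dvd d"] j_def by auto
  moreover have "p ^ Suc k dvd f" using j pi k by (metis le_imp_power_dvd dvd_trans)
  ultimately show ?thesis using pi j k by blast
qed

section \<open>Residues and the number of primes of a given degree\<close>
text \<open>
  The residue ring modulo a prime is a finite domain, so multiplication by a nonzero residue is
  injective and hence bijective; this replaces inverses and Bezout identities.
\<close>
lemma mult_mod_permutes_residues:
  fixes p u :: "'a::{finite,field} poly"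
  assumes p: "monic_irreducible p" and u: "\<not> p dvd u"
  shows "inj_on (\<lambda>h. (u * h) mod p) (polys_below (degree p))"
    and "(\<lambda>h. (u * h) mod p) ` polys_below (degree p) = polys_below (degree p)"
proof -
  show inj: "inj_on (\<lambda>h. (u * h) mod p) (polys_below (degree p))"
  proof (rule inj_onI)
    fix h h' assume h: "h \<in> polys_below (degree p)" "h' \<in> polys_below (degree p)"
      and "(u * h) mod p = (u * h') mod p"
    then have "p dvd u * (h - h')"
      by (simp add: mod_eq_dvd_iff right_diff_distrib)
    then have "p dvd h - h'"
      using p u monic_irreducible_dvd_mult_iff by blast
    then show "h = h'"
      using dvd_in_polys_below_eq_0 polys_below_diff[OF h] by force
  qed
  show "(\<lambda>h. (u * h) mod p) ` polys_below (degree p) = polys_below (degree p)"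
    using inj mod_in_polys_below[OF monic_irreducible_nonzero[OF p]]
    by (intro endo_inj_surj) auto
qed

lemma ex_residue_solution:
  fixes p u g :: "'a::{finite,field} poly"
  assumes "monic_irreducible p" "\<not> p dvd u"
  shows "\<exists>h\<in>polys_below (degree p). p dvd g + u * h"
proof -
  have "(- g) mod p \<in> polys_below (degree p)"
    using assms mod_in_polys_below monic_irreducible_nonzero by blast
  then obtain h where "h \<in> polys_below (degree p)" "(- g) mod p = (u * h) mod p"
    using mult_mod_permutes_residues(2)[OF assms] by (metis (no_types, lifting) imageE)
  then show ?thesis
    by (metis add.commute diff_minus_eq_add mod_eq_dvd_iff)
qed

text \<open>
  Fermat's little theorem in the residue field of \<open>p\<close>: if \<open>p\<close> does not divide
  \<open>u\<close>, multiplication by \<open>u\<close> permutes the nonzero residues, so comparing their products gives \<open>u ^ (|p| - 1) = 1\<close>.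
\<close>
lemma monic_irreducible_dvd_Frobenius:
  fixes p u :: "'a::{finite,field} poly"
  assumes p: "monic_irreducible p"
  shows "p dvd u ^ (CARD('a) ^ degree p) - u"
proof (cases "p dvd u")
  case True
  have "u dvd u ^ (CARD('a) ^ degree p) - u"
    using card_field_ge_2[where 'a='a] by (intro dvd_diff dvd_power) auto
  then show ?thesis using True dvd_trans by blast
next
  case False
  let ?W = "polys_below (degree p) :: 'a poly set" and ?f = "\<lambda>h. (u * h) mod p"
  note perm = mult_mod_permutes_residues[OF p False]
  have "?f 0 = 0" by simp
  have "?f ` (?W - {0}) = ?W - {0}"
    using perm inj_on_image_set_diff[OF perm(1), of ?W "{0}"] by auto
  then have "prod ?f (?W - {0}) = \<Prod>(?W - {0})"
    using prod.reindex[of ?f "?W - {0}" "\<lambda>x. x"] inj_on_subset[OF perm(1), of "?W - {0}"] by auto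
  moreover have "[(\<Prod>h\<in>?W - {0}. u * h) = prod ?f (?W - {0})] (mod p)"
    by (intro cong_prod) (simp add: cong_def)
  moreover have "(\<Prod>h\<in>?W - {0}. u * h) = u ^ (CARD('a) ^ degree p - 1) * \<Prod>(?W - {0})"
    by (simp add: prod.distrib card_polys_below)
  ultimately have "p dvd u ^ (CARD('a) ^ degree p - 1) * \<Prod>(?W - {0}) - \<Prod>(?W - {0})"
    by (simp add: cong_iff_dvd_diff)
  then have "p dvd (u ^ (CARD('a) ^ degree p - 1) - 1) * \<Prod>(?W - {0})"
    by (simp add: left_diff_distrib)
  moreover have "\<not> p dvd \<Prod>(?W - {0})"
    using monic_irreducible_dvd_prod[OF p, of "?W - {0}" "\<lambda>x. x"] dvd_in_polys_below_eq_0
    by auto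
  ultimately have "p dvd u ^ (CARD('a) ^ degree p - 1) - 1"
    using p monic_irreducible_dvd_mult_iff by blast
  then have "p dvd u * (u ^ (CARD('a) ^ degree p - 1) - 1)"
    by simp
  also have "\<dots> = u ^ (CARD('a) ^ degree p) - u"
    by (simp add: right_diff_distrib flip: power_Suc)
  finally show ?thesis .
qed

lemma prod_monic_irreducible_dvd:
  assumes "finite S" "\<And>p. p \<in> S \<Longrightarrow> monic_irreducible p" "\<And>p. p \<in> S \<Longrightarrow> p dvd F"
  shows "\<Prod>S dvd F"
  using assms
proof (induction S rule: finite_induct)
  case (insert p S)
  then obtain k where k: "F = \<Prod>S * k" by auto
  have "\<not> p dvd \<Prod>S"
    using insert monic_irreducible_dvd_prod[of p S "\<lambda>x. x"] monic_irreducible_dvd_eq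
    by (metis insertCI)
  then have "p dvd k"
    using insert.prems k monic_irreducible_dvd_mult_iff by (metis insertCI)
  then show ?case
    using insert k by (simp add: mult.commute)
qed auto

lemma degree_prod_monic_irreducible:
  assumes "\<And>p. p \<in> S \<Longrightarrow> monic_irreducible p"
  shows "degree (\<Prod>S) = (\<Sum>p\<in>S. degree p)"
  using assms monic_irreducible_nonzero by (intro degree_prod_eq_sum_degree) auto

text \<open>
  Distinct primes of degree \<open>j\<close> all divide \<open>x ^ (q ^ j) - x\<close>, hence so does their product. This gains
  a factor \<open>j\<close> over the bound \<open>j * q ^ j\<close> that comes from counting all monic polynomials.
\<close>
lemma sum_degree_monic_irreducibles_of_degree:
  fixes S :: "'a::{finite,field} poly set"
  assumes "finite S" "\<And>p. p \<in> S \<Longrightarrow> monic_irreducible p" "\<And>p. p \<in> S \<Longrightarrow> degree p = j" "j > 0"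
  shows "(\<Sum>p\<in>S. degree p) \<le> CARD('a) ^ j"
proof -
  let ?N = "CARD('a) ^ j" and ?x = "monom 1 1 :: 'a poly"
  have "CARD('a) ^ 1 \<le> ?N"
    using card_field_ge_2[where 'a='a] assms(4) by (intro power_increasing) auto
  then have N: "2 \<le> ?N"
    using card_field_ge_2[where 'a='a] by simp
  have "\<Prod>S dvd ?x ^ ?N - ?x"
    using assms monic_irreducible_dvd_Frobenius[of _ ?x]
    by (intro prod_monic_irreducible_dvd) auto
  moreover have "degree (?x ^ ?N - ?x) = ?N"
    using N by (subst diff_conv_add_uminus, subst degree_add_eq_left)
      (auto simp: monom_power degree_monom_eq)
  moreover have "?x ^ ?N - ?x \<noteq> 0"
    using calculation N by (metis degree_0 not_numeral_le_zero)
  ultimately show ?thesis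
    using assms degree_prod_monic_irreducible by (metis dvd_imp_degree_le)
qed

lemma sum_degree_monic_irreducibles_le:
  fixes S :: "'a::{finite,field} poly set"
  assumes S: "finite S" "\<And>p. p \<in> S \<Longrightarrow> monic_irreducible p" "\<And>p. p \<in> S \<Longrightarrow> degree p \<le> a"
  shows "(CARD('a) - 1) * (\<Sum>p\<in>S. degree p) \<le> CARD('a) ^ Suc a"
proof -
  let ?q = "CARD('a)"
  have "(\<Sum>p\<in>S. degree p) = (\<Sum>j\<in>{1..a}. \<Sum>p\<in>{p\<in>S. degree p = j}. degree p)"
  proof (rule sum.group[symmetric])
    show "degree ` S \<subseteq> {1..a}"
      using S monic_irreducible_degree_pos by force
  qed (use S in auto)
  also have "\<dots> \<le> (\<Sum>j\<in>{1..a}. ?q ^ j)"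
    using S by (intro sum_mono sum_degree_monic_irreducibles_of_degree) auto
  finally have "(?q - 1) * (\<Sum>p\<in>S. degree p) \<le> (?q - 1) * (\<Sum>j\<in>{1..a}. ?q ^ j)"
    by simp
  also have "\<dots> \<le> ?q ^ Suc a"
  proof (induction a)
    case (Suc a)
    have "(?q - 1) * (\<Sum>j\<in>{1..Suc a}. ?q ^ j) = (?q - 1) * (\<Sum>j\<in>{1..a}. ?q ^ j) + (?q - 1) * ?q ^ Suc a"
      by (simp add: distrib_left)
    also have "\<dots> \<le> ?q ^ Suc a + (?q - 1) * ?q ^ Suc a"
      using Suc by simp
    also have "\<dots> = (1 + (?q - 1)) * ?q ^ Suc a"
      by (simp only: distrib_right mult_1)
    also have "\<dots> = ?q ^ Suc (Suc a)"
      using card_field_ge_2[where 'a='a] by simp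
    finally show ?case .
  qed simp
  finally show ?thesis .
qed

lemma ex_avoided_residue:
  fixes p :: "'a::{finite,field} poly"
  assumes "monic_irreducible p" "finite R" "card R < CARD('a) ^ degree p"
  shows "\<exists>t. \<forall>r\<in>R. \<not> p dvd t - r"
proof -
  have "card ((\<lambda>r. r mod p) ` R) < card (polys_below (degree p) :: 'a poly set)"
    using assms card_image_le[of R "\<lambda>r. r mod p"] by (simp add: card_polys_below)
  then have "\<not> (polys_below (degree p) :: 'a poly set) \<subseteq> (\<lambda>r. r mod p) ` R"
    using assms(2) by (meson card_mono finite_imageI not_le)
  then obtain t where t: "t \<in> polys_below (degree p)" "t \<notin> (\<lambda>r. r mod p) ` R"
    by blast
  have "t mod p = t"
    using t(1) by (auto simp: polys_below_iff mod_poly_less)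
  then show ?thesis
    using t(2) by (metis image_eqI mod_eq_dvd_iff)
qed

lemma ex_avoiding_all_residues:
  fixes S :: "'a::{finite,field} poly set"
  assumes "finite S" "\<And>p. p \<in> S \<Longrightarrow> monic_irreducible p"
    and "\<And>p. p \<in> S \<Longrightarrow> finite (R p) \<and> card (R p) < CARD('a) ^ degree p"
  shows "\<exists>u. \<forall>p\<in>S. \<forall>r\<in>R p. \<not> p dvd u - r"
  using assms
proof (induction S rule: finite_induct)
  case (insert p S)
  obtain u where u: "\<forall>p\<in>S. \<forall>r\<in>R p. \<not> p dvd u - r"
    using insert by (metis insertCI)
  obtain t where t: "\<forall>r\<in>R p. \<not> p dvd t - r"
    using insert.prems ex_avoided_residue[of p "R p"] by auto
  have "\<not> p dvd \<Prod>S"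
    using insert monic_irreducible_dvd_prod[of p S "\<lambda>x. x"] monic_irreducible_dvd_eq
    by (metis insertCI)
  then obtain h where h: "p dvd (u - t) + \<Prod>S * h"
    using ex_residue_solution insert.prems(1) by (metis insertI1)
  have "\<not> p' dvd u + \<Prod>S * h - r" if "p' \<in> insert p S" "r \<in> R p'" for p' r
  proof (cases "p' = p")
    case True
    have "u + \<Prod>S * h - r = ((u - t) + \<Prod>S * h) + (t - r)" by simp
    then show ?thesis
      using True h t that by (metis dvd_add_right_iff)
  next
    case False
    then have "p' dvd \<Prod>S * h" "p' \<in> S"
      using that insert.hyps by (auto intro: dvd_mult2)
    moreover have "u + \<Prod>S * h - r = \<Prod>S * h + (u - r)" by simp
    ultimately show ?thesis
      using u that by (metis dvd_add_right_iff)
  qed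
  then show ?case by blast
qed auto

section \<open>Counting polynomials that avoid residues\<close>
definition avoiding ::
    "('a::field poly \<Rightarrow> 'a poly set) \<Rightarrow> 'a poly set \<Rightarrow> 'a poly \<Rightarrow> 'a poly \<Rightarrow> nat \<Rightarrow> 'a poly set"
  where "avoiding R T g Q e = {h \<in> polys_below e. \<forall>p\<in>T. \<forall>r\<in>R p. \<not> p dvd g + Q * h - r}"

definition removed_density ::
    "('a::{finite,field} poly \<Rightarrow> 'a poly set) \<Rightarrow> 'a poly \<Rightarrow> real"
  where "removed_density R p = real (card (R p)) / real CARD('a) ^ degree p"

text \<open>
  The solutions of a residue condition form the same kind of set with smaller parameters. This
  self-similarity drives the induction in \<open>avoiding_density_approx\<close>.
\<close>
lemma polys_below_in_residue_class:
  fixes p :: "'a::{finite,field} poly"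
  assumes p: "monic_irreducible p" and Q: "\<not> p dvd Q" and d: "degree p \<le> e"
  obtains h0 where "p dvd g + Q * h0"
    "{h \<in> polys_below e. p dvd g + Q * h} = (\<lambda>h. h0 + p * h) ` polys_below (e - degree p)"
proof -
  obtain h0 where h0: "h0 \<in> polys_below (degree p)" "p dvd g + Q * h0"
    using ex_residue_solution[OF p Q] by blast
  have p0: "p \<noteq> 0" using p monic_irreducible_nonzero by blast
  have "{h \<in> polys_below e. p dvd g + Q * h} = (\<lambda>h. h0 + p * h) ` polys_below (e - degree p)"
  proof (intro equalityI subsetI)
    fix h assume h: "h \<in> {h \<in> polys_below e. p dvd g + Q * h}"
    have "p dvd (g + Q * h) - (g + Q * h0)"
      using h h0 by (intro dvd_diff) auto
    then have "p dvd Q * (h - h0)" by (simp add: right_diff_distrib)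
    then have "p dvd h - h0" using p Q monic_irreducible_dvd_mult_iff by blast
    then obtain k where k: "h - h0 = p * k" by blast
    have "h - h0 \<in> polys_below e"
      using h h0 polys_below_mono[OF d] by (intro polys_below_diff) auto
    then have "k \<in> polys_below (e - degree p)"
      using mult_in_polys_below_iff[OF p0, of k "e - degree p"] k d by simp
    then show "h \<in> (\<lambda>h. h0 + p * h) ` polys_below (e - degree p)"
      using k by (intro image_eqI[of _ _ k]) (auto simp: algebra_simps)
  next
    fix h assume "h \<in> (\<lambda>h. h0 + p * h) ` polys_below (e - degree p)"
    then obtain k where k: "h = h0 + p * k" "k \<in> polys_below (e - degree p)" by blast
    have "p * k \<in> polys_below e"
      using mult_in_polys_below_iff[OF p0, of k "e - degree p"] k d by simp
    then have "h \<in> polys_below e"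
      using k h0 polys_below_mono[OF d] by (auto intro: polys_below_add)
    moreover have eq: "g + Q * h = (g + Q * h0) + p * (Q * k)"
      using k by (simp add: algebra_simps)
    have "p dvd g + Q * h"
      unfolding eq by (rule dvd_add[OF h0(2) dvd_triv_left])
    ultimately show "h \<in> {h \<in> polys_below e. p dvd g + Q * h}"
      by blast
  qed
  with h0 that show ?thesis by blast
qed

lemma card_polys_below_in_residue_class_le:
  fixes p :: "'a::{finite,field} poly"
  assumes p: "monic_irreducible p" and Q: "\<not> p dvd Q" and c: "c \<le> degree p" "c \<le> e"
  shows "card {h \<in> polys_below e. p dvd g + Q * h} \<le> CARD('a) ^ (e - c)"
proof (cases "degree p \<le> e")
  case True
  obtain h0 where
    "{h \<in> polys_below e. p dvd g + Q * h} = (\<lambda>h. h0 + p * h) ` polys_below (e - degree p)"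
    using polys_below_in_residue_class[OF p Q True] by metis
  then have "card {h \<in> polys_below e. p dvd g + Q * h} \<le> CARD('a) ^ (e - degree p)"
    using card_image_le[of "polys_below (e - degree p)" "\<lambda>h. h0 + p * h"]
    by (simp add: card_polys_below)
  also have "\<dots> \<le> CARD('a) ^ (e - c)"
    using c by (intro power_increasing) (auto simp: Suc_leI)
  finally show ?thesis .
next
  case False
  have "h = h'" if "h \<in> polys_below e" "h' \<in> polys_below e" "p dvd g + Q * h" "p dvd g + Q * h'" for h h'
  proof -
    have "p dvd (g + Q * h) - (g + Q * h')" using that(3,4) by (rule dvd_diff)
    then have "p dvd Q * (h - h')" by (simp add: right_diff_distrib)
    then have "p dvd h - h'" using p Q monic_irreducible_dvd_mult_iff by blast
    moreover have "h - h' \<in> polys_below (degree p)"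
      using polys_below_diff[OF that(1,2)] polys_below_mono[of e "degree p"] False by auto
    ultimately have "h - h' = 0" by (rule dvd_in_polys_below_eq_0)
    then show ?thesis by simp
  qed
  then have "card {h \<in> polys_below e. p dvd g + Q * h} \<le> Suc 0"
    by (subst card_le_Suc0_iff_eq) auto
  also have "Suc 0 \<le> CARD('a) ^ (e - c)" by (simp add: Suc_leI)
  finally show ?thesis .
qed

lemma power_Suc_add_ge:
  fixes x y :: real
  assumes "0 \<le> x" "0 \<le> y"
  shows "x ^ Suc k + real (Suc k) * y * x ^ k \<le> (x + y) ^ Suc k"
proof (induction k)
  case (Suc k)
  have "x ^ Suc (Suc k) + real (Suc (Suc k)) * y * x ^ Suc k
      \<le> (x + y) * (x ^ Suc k + real (Suc k) * y * x ^ k)"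
    using assms by (simp add: algebra_simps)
  also have "\<dots> \<le> (x + y) * (x + y) ^ Suc k"
    using Suc assms by (intro mult_left_mono) auto
  finally show ?case by simp
qed simp

lemma removed_density_bounds:
  fixes R :: "'a::{finite,field} poly \<Rightarrow> 'a poly set"
  assumes "R p \<subseteq> polys_below (degree p)"
  shows "0 \<le> removed_density R p" "removed_density R p \<le> 1"
proof -
  have "card (R p) \<le> CARD('a) ^ degree p"
    using card_mono[OF finite_polys_below assms] by (simp add: card_polys_below)
  then have "real (card (R p)) \<le> real (CARD('a) ^ degree p)"
    by (rule of_nat_mono)
  then show "removed_density R p \<le> 1"
    by (simp add: removed_density_def)
qed (simp add: removed_density_def)

text \<open>
  Truncated inclusion-exclusion (Brun's pure sieve). As soon as \<open>polys_below e\<close> has room for \<open>k\<close>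
  of the primes simultaneously, the proportion of polynomials avoiding all residues differs from the
  value expected under independence by at most the \<open>k\<close>-th term of the exponential series of the
  removed mass.

  The error bound is proved directly by induction on the set of primes, without expanding over its
  subsets: the polynomials avoiding \<open>T\<close> and \<open>p\<close> are those avoiding \<open>T\<close>, minus those that avoid \<open>T\<close>
  inside one of the removed classes modulo \<open>p\<close>. The first count is estimated with order \<open>k\<close>, the
  others, which live in a space smaller by \<open>degree p\<close>, with order \<open>k - 1\<close>. The errors add up by
  \<open>power_Suc_add_ge\<close>.
\<close>
lemma avoiding_density_approx:
  fixes R :: "'a::{finite,field} poly \<Rightarrow> 'a poly set"
  assumes "finite T"
    and "\<And>p. p \<in> T \<Longrightarrow> monic_irreducible p \<and> degree p \<le> J \<and> \<not> p dvd Q \<and> R p \<subseteq> polys_below (degree p)"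
    and "k * J \<le> e"
  shows "\<bar>real (card (avoiding R T g Q e)) / real CARD('a) ^ e - (\<Prod>p\<in>T. 1 - removed_density R p)\<bar>
         \<le> (\<Sum>p\<in>T. removed_density R p) ^ k / fact k"
  using assms
proof (induction T arbitrary: k g Q e rule: finite_induct)
  case empty
  have "avoiding R {} g Q e = polys_below e" by (auto simp: avoiding_def)
  then show ?case by (simp add: card_polys_below)
next
  case (insert p T)
  let ?q = "real CARD('a)" and ?w = "removed_density R"
  have fin: "finite (avoiding R S g Q e)" for S g Q e
    by (auto simp: avoiding_def)
  have bounds: "0 \<le> ?w p'" "?w p' \<le> 1" if "p' \<in> insert p T" for p'
    using removed_density_bounds insert.prems(1)[OF that] by blast+
  have prod01: "0 \<le> (\<Prod>p\<in>S. 1 - ?w p)" "(\<Prod>p\<in>S. 1 - ?w p) \<le> 1" if "S \<subseteq> insert p T" for S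
    using bounds that by (auto intro!: prod_nonneg prod_le_1 simp: subset_iff)
  show ?case
  proof (cases k)
    case 0
    have "card (avoiding R (insert p T) g Q e) \<le> CARD('a) ^ e"
      using card_mono[of "polys_below e" "avoiding R (insert p T) g Q e"]
      by (auto simp: card_polys_below avoiding_def)
    then have "real (card (avoiding R (insert p T) g Q e)) \<le> real (CARD('a) ^ e)"
      by (rule of_nat_mono)
    then have "real (card (avoiding R (insert p T) g Q e)) / ?q ^ e \<le> 1"
      by simp
    moreover have "0 \<le> real (card (avoiding R (insert p T) g Q e)) / ?q ^ e"
      by simp
    ultimately have "\<bar>real (card (avoiding R (insert p T) g Q e)) / ?q ^ e - (\<Prod>p\<in>insert p T. 1 - ?w p)\<bar> \<le> 1"
      using prod01[OF subset_refl] by linarith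
    then show ?thesis
      using 0 by simp
  next
    case (Suc k')
    let ?d = "degree p"
    let ?N = "\<lambda>S g Q e. real (card (avoiding R S g Q e)) / ?q ^ e"
    let ?P = "\<Prod>p\<in>T. 1 - ?w p" and ?s = "\<Sum>p\<in>T. ?w p"
    have p: "monic_irreducible p" "?d \<le> J" "\<not> p dvd Q" "R p \<subseteq> polys_below ?d"
      using insert.prems(1)[of p] by auto
    have p0: "p \<noteq> 0" using p monic_irreducible_nonzero by blast
    have e: "?d \<le> e" "k' * J \<le> e - ?d"
      using insert.prems(2) p Suc by auto
    have finR: "finite (R p)" using finite_subset[OF p(4) finite_polys_below] .
    define B where "B = (\<lambda>r. {h \<in> avoiding R T g Q e. p dvd g + Q * h - r})"
    have B: "\<exists>g'. card (B r) = card (avoiding R T g' (Q * p) (e - ?d))" for r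
    proof -
      obtain h0 where h0: "{h \<in> polys_below e. p dvd (g - r) + Q * h} = (\<lambda>h. h0 + p * h) ` polys_below (e - ?d)"
        using polys_below_in_residue_class[OF p(1,3) e(1), of "g - r"] by metis
      have "B r = {h \<in> {h \<in> polys_below e. p dvd (g - r) + Q * h}. \<forall>p\<in>T. \<forall>r\<in>R p. \<not> p dvd g + Q * h - r}"
        by (auto simp: B_def avoiding_def algebra_simps)
      also have "\<dots> = (\<lambda>h. h0 + p * h) ` avoiding R T (g + Q * h0) (Q * p) (e - ?d)"
        unfolding h0 by (auto simp: avoiding_def algebra_simps)
      finally have "card (B r) = card (avoiding R T (g + Q * h0) (Q * p) (e - ?d))"
        using p0 by (simp add: card_image inj_on_def)
      then show ?thesis by blast
    qed
    have "card (avoiding R T g Q e) = card (avoiding R (insert p T) g Q e \<union> (\<Union>r\<in>R p. B r))"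
      by (rule arg_cong[where f = card]) (auto simp: avoiding_def B_def)
    also have "\<dots> = card (avoiding R (insert p T) g Q e) + card (\<Union>r\<in>R p. B r)"
      using finR fin by (intro card_Un_disjoint) (auto simp: B_def avoiding_def)
    also have "card (\<Union>r\<in>R p. B r) = (\<Sum>r\<in>R p. card (B r))"
    proof (rule card_UN_disjoint)
      have "r = r'" if "r \<in> R p" "r' \<in> R p" "h \<in> B r" "h \<in> B r'" for r r' h
      proof -
        have "p dvd g + Q * h - r'" "p dvd g + Q * h - r"
          using that by (auto simp: B_def)
        then have "p dvd (g + Q * h - r') - (g + Q * h - r)" by (rule dvd_diff)
        then have "p dvd r - r'" by simp
        moreover have "r - r' \<in> polys_below ?d" using that p by (intro polys_below_diff) auto
        ultimately have "r - r' = 0" by (rule dvd_in_polys_below_eq_0)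
        then show ?thesis by simp
      qed
      then show "\<forall>i\<in>R p. \<forall>j\<in>R p. i \<noteq> j \<longrightarrow> B i \<inter> B j = {}" by blast
    qed (use finR fin in \<open>simp_all add: B_def\<close>)
    finally have "real (card (avoiding R T g Q e)) = 
        real (card (avoiding R (insert p T) g Q e)) + (\<Sum>r\<in>R p. real (card (B r)))"
      by simp
    then have split: "?N (insert p T) g Q e = ?N T g Q e - (\<Sum>r\<in>R p. real (card (B r)) / ?q ^ e)"
      by (simp add: diff_divide_distrib add_divide_distrib flip: sum_divide_distrib)
    have IH1: "\<bar>?N T g Q e - ?P\<bar> \<le> ?s ^ Suc k' / fact (Suc k')"
    proof (rule insert.IH)
      show "monic_irreducible p' \<and> degree p' \<le> J \<and> \<not> p' dvd Q \<and> R p' \<subseteq> polys_below (degree p')"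
        if "p' \<in> T" for p'
        using insert.prems(1)[of p'] that by blast
      show "Suc k' * J \<le> e" using insert.prems(2) Suc by blast
    qed
    have IH2: "\<bar>real (card (B r)) / ?q ^ e - ?P / ?q ^ ?d\<bar> \<le> ?s ^ k' / fact k' / ?q ^ ?d" for r
    proof -
      obtain g' where g': "card (B r) = card (avoiding R T g' (Q * p) (e - ?d))" using B by blast
      have "\<bar>?N T g' (Q * p) (e - ?d) - ?P\<bar> \<le> ?s ^ k' / fact k'"
      proof (rule insert.IH)
        show "monic_irreducible p' \<and> degree p' \<le> J \<and> \<not> p' dvd Q * p \<and> R p' \<subseteq> polys_below (degree p')"
          if "p' \<in> T" for p'
          using that insert.prems(1)[of p'] p(1) insert.hyps(2) monic_irreducible_dvd_mult_iff[of p' Q p]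
            monic_irreducible_dvd_eq[of p' p] by blast
        show "k' * J \<le> e - ?d" by (rule e(2))
      qed
      then have "\<bar>?N T g' (Q * p) (e - ?d) - ?P\<bar> / ?q ^ ?d \<le> ?s ^ k' / fact k' / ?q ^ ?d"
        by (intro divide_right_mono) auto
      moreover have eq: "real (card (B r)) / ?q ^ e = ?N T g' (Q * p) (e - ?d) / ?q ^ ?d"
        using e g' by (simp flip: power_add)
      have "\<bar>real (card (B r)) / ?q ^ e - ?P / ?q ^ ?d\<bar> = \<bar>?N T g' (Q * p) (e - ?d) - ?P\<bar> / ?q ^ ?d"
        unfolding eq diff_divide_distrib[symmetric] abs_divide by simp
      ultimately show ?thesis
        by simp
    qed
    have "(\<Prod>p\<in>insert p T. 1 - ?w p) = ?P - (\<Sum>r\<in>R p. ?P / ?q ^ ?d)"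
      using insert.hyps by (simp add: removed_density_def[of R p] left_diff_distrib)
    then have "\<bar>?N (insert p T) g Q e - (\<Prod>p\<in>insert p T. 1 - ?w p)\<bar>
        = \<bar>(?N T g Q e - ?P) - (\<Sum>r\<in>R p. real (card (B r)) / ?q ^ e - ?P / ?q ^ ?d)\<bar>"
      unfolding split by (simp add: sum_subtractf)
    also have "\<dots> \<le> \<bar>?N T g Q e - ?P\<bar> + (\<Sum>r\<in>R p. \<bar>real (card (B r)) / ?q ^ e - ?P / ?q ^ ?d\<bar>)"
      by (rule order_trans[OF abs_triangle_ineq4 add_left_mono[OF sum_abs]])
    also have "\<dots> \<le> ?s ^ Suc k' / fact (Suc k') + (\<Sum>r\<in>R p. ?s ^ k' / fact k' / ?q ^ ?d)"
      by (intro add_mono IH1 sum_mono IH2)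
    also have "\<dots> = (?s ^ Suc k' + real (Suc k') * ?w p * ?s ^ k') / fact (Suc k')"
    proof -
      have "a / fact (Suc k') + c * (b / fact k' / d) = (a + real (Suc k') * (c / d) * b) / fact (Suc k')"
        for a b c d :: real
        by (simp add: add_divide_distrib)
      then show ?thesis
        by (simp only: removed_density_def[of R p] sum_constant)
    qed
    also have "\<dots> \<le> (?s + ?w p) ^ Suc k' / fact (Suc k')"
      using bounds by (intro divide_right_mono power_Suc_add_ge sum_nonneg) auto
    finally show ?thesis
      using insert.hyps Suc by (simp add: add.commute)
  qed
qed

section \<open>A sieve with optimal cost per removed residue\<close>
lemma prod_one_minus_ge_exp:
  fixes w :: "'b \<Rightarrow> real"
  assumes "finite T" "\<And>p. p \<in> T \<Longrightarrow> 0 \<le> w p \<and> w p \<le> 1 / 2"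
  shows "exp (- 2 * (\<Sum>p\<in>T. w p)) \<le> (\<Prod>p\<in>T. 1 - w p)"
proof -
  have "exp (- 2 * x) \<le> 1 - x" if "0 \<le> x" "x \<le> 1 / 2" for x :: real
  proof -
    have "x * x \<le> x * (1 / 2)" using that by (intro mult_left_mono)
    then have "- 2 * x \<le> - x - 2 * x\<^sup>2" by (simp add: power2_eq_square)
    also have "\<dots> \<le> ln (1 - x)" by (rule ln_one_minus_pos_lower_bound[OF that])
    finally have "exp (- 2 * x) \<le> exp (ln (1 - x))" by simp
    then show ?thesis using that by simp
  qed
  then have "(\<Prod>p\<in>T. exp (- 2 * w p)) \<le> (\<Prod>p\<in>T. 1 - w p)"
    using assms by (intro prod_mono) auto
  then show ?thesis
    using assms(1) by (simp add: exp_sum sum_distrib_left)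
qed

text \<open>
  The primes are treated in three ways. Those in \<open>S\<close> are handled exactly by the Chinese remainder
  theorem, at the cost of their total degree. In the remaining coset of the product of \<open>S\<close>, the primes in \<open>T\<close>
  are sieved, which leaves a proportion of at least \<open>exp (- 2 w)\<close> up to the truncation error, where \<open>w\<close> is
  the mass that \<open>T\<close> removes. The primes in \<open>L\<close> have so large a degree that removing their residue
  classes one by one from what is left does no harm.
\<close>
lemma ex_avoiding_three_ranges:
  fixes R :: "'a::{finite,field} poly \<Rightarrow> 'a poly set"
  assumes fin: "finite S" "finite T" "finite L" and disj: "S \<inter> T = {}" "S \<inter> L = {}"
    and irr: "\<And>p. p \<in> S \<union> T \<union> L \<Longrightarrow> monic_irreducible p"
    and R: "\<And>p. p \<in> S \<union> T \<union> L \<Longrightarrow> R p \<subseteq> polys_below (degree p) \<and> card (R p) < CARD('a) ^ degree p"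
    and T: "\<And>p. p \<in> T \<Longrightarrow> degree p \<le> J \<and> removed_density R p \<le> 1 / 2" and kJ: "k * J \<le> e"
    and L: "\<And>p. p \<in> L \<Longrightarrow> c \<le> degree p" and ce: "c \<le> e"
    and small: "(\<Sum>p\<in>T. removed_density R p) ^ k / fact k + (\<Sum>p\<in>L. real (card (R p))) / real CARD('a) ^ c
      < exp (- 2 * (\<Sum>p\<in>T. removed_density R p))"
  shows "\<exists>u\<in>polys_below ((\<Sum>p\<in>S. degree p) + e). \<forall>p\<in>S \<union> T \<union> L. \<forall>r\<in>R p. \<not> p dvd u - r"
proof -
  let ?q = "real CARD('a)" and ?w = "removed_density R" and ?Q = "\<Prod>S"
  have finR: "finite (R p)" if "p \<in> S \<union> T \<union> L" for p
    using finite_subset[OF _ finite_polys_below] R[OF that] by blast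
  have "\<exists>u. \<forall>p\<in>S. \<forall>r\<in>R p. \<not> p dvd u - r"
    using fin(1) irr R finR by (intro ex_avoiding_all_residues) auto
  then obtain u0 where u0: "\<And>p r. p \<in> S \<Longrightarrow> r \<in> R p \<Longrightarrow> \<not> p dvd u0 - r"
    by blast
  have ndvd: "\<not> p dvd ?Q" if "p \<in> T \<union> L" for p
  proof
    assume "p dvd ?Q"
    moreover have "monic_irreducible p"
      using irr that by blast
    ultimately obtain p' where "p' \<in> S" "p dvd p'"
      using monic_irreducible_dvd_prod[of p S "\<lambda>x. x"] fin(1) by blast
    then show False
      using monic_irreducible_dvd_eq[of p p'] irr[of p] irr[of p'] that disj by blast
  qed
  define u1 where "u1 = u0 mod ?Q"
  have Q0: "?Q \<noteq> 0"
    using fin(1) irr monic_irreducible_nonzero by (metis UnI1 prod_zero_iff)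
  have degQ: "degree ?Q = (\<Sum>p\<in>S. degree p)"
    using irr by (intro degree_prod_monic_irreducible) auto
  define N where "N = avoiding R T u1 ?Q e"
  define B where "B = (\<Union>p\<in>L. \<Union>r\<in>R p. {h \<in> polys_below e. p dvd (u1 - r) + ?Q * h})"
  have "card B \<le> (\<Sum>p\<in>L. card (\<Union>r\<in>R p. {h \<in> polys_below e. p dvd (u1 - r) + ?Q * h}))"
    unfolding B_def by (rule card_UN_le[OF fin(3)])
  also have "\<dots> \<le> (\<Sum>p\<in>L. \<Sum>r\<in>R p. card {h \<in> polys_below e. p dvd (u1 - r) + ?Q * h})"
    using finR by (intro sum_mono card_UN_le) auto
  also have "\<dots> \<le> (\<Sum>p\<in>L. \<Sum>r\<in>R p. CARD('a) ^ (e - c))"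
    using irr ndvd L ce by (intro sum_mono card_polys_below_in_residue_class_le) auto
  also have "\<dots> = (\<Sum>p\<in>L. card (R p)) * CARD('a) ^ (e - c)"
    by (simp add: sum_distrib_right)
  finally have "real (card B) \<le> real ((\<Sum>p\<in>L. card (R p)) * CARD('a) ^ (e - c))"
    by (rule of_nat_mono)
  also have "\<dots> = (\<Sum>p\<in>L. real (card (R p))) * ?q ^ (e - c)"
    by simp
  also have "\<dots> = (\<Sum>p\<in>L. real (card (R p))) / ?q ^ c * ?q ^ e"
    using ce by (simp add: power_diff)
  finally have cardB: "real (card B) \<le> (\<Sum>p\<in>L. real (card (R p))) / ?q ^ c * ?q ^ e" .
  have "\<bar>real (card N) / ?q ^ e - (\<Prod>p\<in>T. 1 - ?w p)\<bar> \<le> (\<Sum>p\<in>T. ?w p) ^ k / fact k"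
    unfolding N_def
  proof (rule avoiding_density_approx[OF fin(2) _ kJ])
    show "monic_irreducible p \<and> degree p \<le> J \<and> \<not> p dvd ?Q \<and> R p \<subseteq> polys_below (degree p)"
      if "p \<in> T" for p
      using that irr[of p] T[of p] ndvd[of p] R[of p] by blast
  qed
  moreover have "exp (- 2 * (\<Sum>p\<in>T. ?w p)) \<le> (\<Prod>p\<in>T. 1 - ?w p)"
  proof (rule prod_one_minus_ge_exp[OF fin(2)])
    show "0 \<le> ?w p \<and> ?w p \<le> 1 / 2" if "p \<in> T" for p
      using T[OF that] by (simp add: removed_density_def)
  qed
  ultimately have "(\<Sum>p\<in>L. real (card (R p))) / ?q ^ c < real (card N) / ?q ^ e"
    using small by linarith
  then have "(\<Sum>p\<in>L. real (card (R p))) / ?q ^ c * ?q ^ e < real (card N) / ?q ^ e * ?q ^ e"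
    by (rule mult_strict_right_mono) simp
  also have "\<dots> = real (card N)"
    by simp
  finally have "card B < card N"
    using cardB by linarith
  moreover have "finite B"
    by (rule finite_subset[OF _ finite_polys_below[of e]]) (auto simp: B_def)
  ultimately have "\<not> N \<subseteq> B"
    by (meson card_mono not_le)
  then obtain h where h: "h \<in> N" "h \<notin> B"
    by blast
  have he: "h \<in> polys_below e" using h by (simp add: N_def avoiding_def)
  let ?u = "u1 + ?Q * h"
  have "u1 \<in> polys_below (degree ?Q)"
    unfolding u1_def by (rule mod_in_polys_below[OF Q0])
  then have "u1 \<in> polys_below (degree ?Q + e)"
    using polys_below_mono[of "degree ?Q" "degree ?Q + e"] by auto
  moreover have "?Q * h \<in> polys_below (degree ?Q + e)"
    using mult_in_polys_below_iff[OF Q0] he by blast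
  ultimately have "?u \<in> polys_below (degree ?Q + e)"
    by (rule polys_below_add)
  moreover have "\<not> p dvd ?u - r" if p: "p \<in> S \<union> T \<union> L" and r: "r \<in> R p" for p r
  proof -
    consider "p \<in> S" | "p \<in> T" | "p \<in> L" using p by blast
    then show ?thesis
    proof cases
      case 1
      have "p dvd ?Q" using dvd_prodI[OF fin(1) 1, of "\<lambda>x. x"] by simp
      moreover have "?Q dvd u1 - u0"
        unfolding u1_def by (metis dvd_minus_mod dvd_minus_iff minus_diff_eq)
      ultimately have "p dvd (u1 - u0) + ?Q * h"
        by (meson dvd_add dvd_mult2 dvd_trans)
      moreover have "?u - r = ((u1 - u0) + ?Q * h) + (u0 - r)" by simp
      ultimately show ?thesis
        using u0[OF 1 r] by (metis dvd_add_right_iff)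
    next
      case 2
      then show ?thesis using h(1) r by (simp add: N_def avoiding_def)
    next
      case 3
      have eq: "?u - r = (u1 - r) + ?Q * h" by simp
      have "h \<in> B" if "p dvd ?u - r"
        unfolding B_def using that[unfolded eq] 3 r he by blast
      then show ?thesis using h(2) by blast
    qed
  qed
  ultimately show ?thesis
    unfolding degQ by blast
qed

lemma ex_sieve_order:
  fixes x y :: real
  assumes "0 < y"
  shows "\<exists>k>0. x ^ k / fact k < y"
proof -
  have "(\<lambda>k. x ^ k / fact k) \<longlonglongrightarrow> 0"
    using summable_LIMSEQ_zero[OF summable_exp[of x]] by (simp add: field_simps)
  then have "eventually (\<lambda>k. x ^ k / fact k < y) sequentially"
    using assms by (rule order_tendstoD)
  then have "eventually (\<lambda>k. k > 0 \<and> x ^ k / fact k < y) sequentially"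
    using eventually_gt_at_top by (rule eventually_conj[rotated])
  then show ?thesis
    using eventually_happens trivial_limit_sequentially by blast
qed

text \<open>
  The three requirements on the size of \<open>a\<close>: primes of degree above \<open>a\<close> that survive the first selection
  lose at most half of their residues; the room \<open>3 a k\<close> for the sieve is affordable; and the primes of
  degree above \<open>3 a\<close> are negligible.
\<close>
lemma ex_sieve_threshold:
  fixes q k :: nat and y :: real
  assumes q: "2 \<le> q" and y: "0 < y"
  shows "\<exists>a0. \<forall>a\<ge>a0. real (8 * (q - 1) * a) \<le> real q ^ a \<and> 3 * a * k * (q - 1) \<le> 2 * q ^ Suc a
    \<and> 4 * real q ^ (a + 2) / real q ^ (3 * a) < y"
proof -
  have lim1: "(\<lambda>a. real a / real q ^ a) \<longlonglongrightarrow> 0"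
    using lim_n_over_pown[of "real q"] q by simp
  have lim2: "(\<lambda>a. 4 * real q ^ 2 / real q ^ a) \<longlonglongrightarrow> 0"
    using q by (intro LIMSEQ_divide_realpow_zero) auto
  have "0 < 1 / real (8 * (q - 1))" using q by simp
  note ev1 = order_tendstoD(2)[OF lim1 this]
  have "0 < 1 / real (Suc (3 * k * (q - 1)))" by (simp only: zero_less_divide_1_iff of_nat_0_less_iff zero_less_Suc)
  note ev2 = order_tendstoD(2)[OF lim1 this]
  have "eventually (\<lambda>a. real (8 * (q - 1) * a) \<le> real q ^ a \<and> 3 * a * k * (q - 1) \<le> 2 * q ^ Suc a
    \<and> 4 * real q ^ (a + 2) / real q ^ (3 * a) < y) sequentially"
    using ev1 ev2 order_tendstoD(2)[OF lim2 y]
  proof eventually_elim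
    case (elim a)
    have qa: "0 < real q ^ a" using q by simp
    have cross: "x * N \<le> z" if "x / z < 1 / N" "0 < z" "0 < N" for x z N :: real
      using that by (simp add: field_simps)
    have "real a * real (8 * (q - 1)) \<le> real q ^ a"
      by (rule cross[OF elim(1) qa]) (use q in simp)
    then have 1: "real (8 * (q - 1) * a) \<le> real q ^ a"
      by (simp add: mult_ac)
    have "real a * real (Suc (3 * k * (q - 1))) \<le> real q ^ a"
      by (rule cross[OF elim(2) qa]) (simp only: of_nat_0_less_iff zero_less_Suc)
    then have "real (a * Suc (3 * k * (q - 1))) \<le> real (q ^ a)"
      by (simp only: of_nat_mult of_nat_power)
    then have "a * Suc (3 * k * (q - 1)) \<le> q ^ a"
      by (simp only: of_nat_le_iff)
    moreover have "3 * a * k * (q - 1) \<le> a * Suc (3 * k * (q - 1))"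
      by simp
    moreover have "q ^ a \<le> 2 * q ^ Suc a"
      using q by simp
    ultimately have 2: "3 * a * k * (q - 1) \<le> 2 * q ^ Suc a"
      by linarith
    have "3 * a = a + a + a" by simp
    then have q3a: "real q ^ (3 * a) = real q ^ a * real q ^ a * real q ^ a"
      by (simp only: power_add)
    have "4 * real q ^ (a + 2) / real q ^ (3 * a) = 4 * real q ^ 2 / (real q ^ a * real q ^ a)"
      unfolding q3a using q by (simp add: power_add power2_eq_square)
    also have "\<dots> \<le> 4 * real q ^ 2 / real q ^ a"
      using q one_le_power[of "real q" a] by (intro divide_left_mono) auto
    also have "\<dots> < y" by (rule elim(3))
    finally show ?case using 1 2 by blast
  qed
  then show ?thesis
    by (simp add: eventually_sequentially)
qed

lemma ex_power_bracket:
  fixes q m a0 :: nat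
  assumes "2 \<le> q" "4 * q ^ Suc a0 \<le> m"
  obtains a where "a0 \<le> a" "4 * q ^ Suc a \<le> m" "m < 4 * q ^ (a + 2)"
proof -
  define P where "P = (\<lambda>a. m < 4 * q ^ (a + 2))"
  have "m < 2 ^ m" by (rule less_exp)
  also have "\<dots> \<le> q ^ m" using assms(1) by (intro power_mono) auto
  also have "\<dots> \<le> q ^ (m + 2)" using assms(1) by (intro power_increasing) auto
  finally have "P m" by (simp add: P_def)
  define a where "a = (LEAST a. a0 \<le> a \<and> P a)"
  have "a0 \<le> a0 + m \<and> P (a0 + m)"
  proof -
    have "q ^ (m + 2) \<le> q ^ (a0 + m + 2)" using assms(1) by (intro power_increasing) auto
    then show ?thesis using \<open>P m\<close> unfolding P_def by linarith
  qed
  then have a: "a0 \<le> a" "P a"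
    unfolding a_def using LeastI[of "\<lambda>a. a0 \<le> a \<and> P a" "a0 + m"] by auto
  have "4 * q ^ Suc a \<le> m"
  proof (cases "a = a0")
    case False
    then obtain b where b: "a = Suc b" "a0 \<le> b" using a(1) by (cases a) auto
    then have "\<not> P b"
      using not_less_Least[of b "\<lambda>a. a0 \<le> a \<and> P a"] a_def by auto
    then show ?thesis using b by (simp add: P_def)
  qed (use assms in simp)
  then show ?thesis using that a P_def by blast
qed

text \<open>
  Let \<open>m\<close> be the total number of removed residues.
  If \<open>m\<close> is bounded, the Chinese remainder theorem for the primes of bounded degree suffices,
  because the removed mass of all others is below \<open>1\<close>.
  Otherwise let \<open>4 q^(a+1) \<le> m < 4 q^(a+2)\<close>. The primes of degree at most \<open>a\<close> have total degree at most
  \<open>q^(a+1) / (q-1) \<le> m / (4 (q-1))\<close>, and the primes \<open>p\<close> with at least \<open>4 (q-1) degree p\<close> removed residues have total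
  degree at most \<open>m / (4 (q-1))\<close>, so the Chinese remainder theorem can afford both. The other primes
  have degree above \<open>a\<close>, hence their removed mass is at most \<open>m / q^(a+1) < 4 q\<close>, independently of \<open>m\<close>.
  So a truncation order \<open>k\<close> depending only on \<open>q\<close> works for degrees up to \<open>3 a\<close>, and it
  needs only \<open>3 a k = O(log m)\<close> further degrees. Beyond degree \<open>3 a\<close> the mass is \<open>O(q^(-2 a))\<close>,
  which is below any constant.
\<close>
lemma ex_avoiding_below_sum_of_residues:
  "\<exists>C. \<forall>(\<P> :: 'a::{finite,field} poly set) R.
     finite \<P> \<longrightarrow> (\<forall>p\<in>\<P>. monic_irreducible p \<and> R p \<subseteq> polys_below (degree p) \<and> card (R p) < CARD('a) ^ degree p)
     \<longrightarrow> (\<exists>D. (CARD('a) - 1) * D \<le> (\<Sum>p\<in>\<P>. card (R p)) + C \<and>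
           (\<exists>u\<in>polys_below D. \<forall>p\<in>\<P>. \<forall>r\<in>R p. \<not> p dvd u - r))"
proof -
  let ?q = "CARD('a)"
  have q: "2 \<le> ?q" by (rule card_field_ge_2)
  \<comment> \<open>Half of the proportion that is certain to survive a removed mass of at most \<open>4 q\<close>: the
    truncation error and the primes of large degree each receive one such half.\<close>
  define y where "y = exp (- 2 * (4 * real ?q)) / 2"
  have y: "0 < y" by (simp add: y_def)
  obtain k where k: "k > 0" "(4 * real ?q) ^ k / fact k < y"
    using ex_sieve_order[OF y] by blast
  obtain a0 where a0: "\<And>a. a0 \<le> a \<Longrightarrow> real (8 * (?q - 1) * a) \<le> real ?q ^ a"
      "\<And>a. a0 \<le> a \<Longrightarrow> 3 * a * k * (?q - 1) \<le> 2 * ?q ^ Suc a"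
      "\<And>a. a0 \<le> a \<Longrightarrow> 4 * real ?q ^ (a + 2) / real ?q ^ (3 * a) < y"
    using ex_sieve_threshold[OF q y, of k] by metis
  \<comment> \<open>Chosen such that \<open>4 q^(a0+1) \<le> q^c\<close>.\<close>
  define c where "c = a0 + 3"
  define C where "C = ?q ^ Suc c + (?q - 1) * c"
  have main: "\<exists>D. (?q - 1) * D \<le> (\<Sum>p\<in>\<P>. card (R p)) + C \<and>
           (\<exists>u\<in>polys_below D. \<forall>p\<in>\<P>. \<forall>r\<in>R p. \<not> p dvd u - r)"
    if fin: "finite \<P>"
      and PR: "\<And>p. p \<in> \<P> \<Longrightarrow> monic_irreducible p \<and> R p \<subseteq> polys_below (degree p) \<and> card (R p) < ?q ^ degree p"
    for \<P> :: "'a poly set" and R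
  proof -
    define m where "m = (\<Sum>p\<in>\<P>. card (R p))"
    have m_subset: "(\<Sum>p\<in>A. card (R p)) \<le> m" if "A \<subseteq> \<P>" for A
      unfolding m_def using fin that by (intro sum_mono2) auto
    show ?thesis
    proof (cases "4 * ?q ^ Suc a0 \<le> m")
      case False
      define S where "S = {p\<in>\<P>. degree p \<le> c}"
      \<comment> \<open>No prime is sieved, so the order \<open>k = 1\<close> has error \<open>0\<close>.\<close>
      have "\<exists>u\<in>polys_below ((\<Sum>p\<in>S. degree p) + c). \<forall>p\<in>S \<union> {} \<union> (\<P> - S). \<forall>r\<in>R p. \<not> p dvd u - r"
      proof (rule ex_avoiding_three_ranges[where k = 1 and J = 0 and c = c])
        have "m < 4 * ?q ^ Suc a0" using False by simp
        also have "\<dots> \<le> ?q\<^sup>2 * ?q ^ Suc a0"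
          using power_mono[OF q, of 2] by (intro mult_right_mono) auto
        also have "\<dots> = ?q ^ c" by (simp add: c_def power2_eq_square power3_eq_cube power_add)
        finally have "(\<Sum>p\<in>\<P> - S. card (R p)) < ?q ^ c"
          using m_subset[of "\<P> - S"] by auto
        then have "real (\<Sum>p\<in>\<P> - S. card (R p)) < real (?q ^ c)"
          by (rule of_nat_less_iff[THEN iffD2])
        then show "(\<Sum>p\<in>{}. removed_density R p) ^ 1 / fact 1 + (\<Sum>p\<in>\<P> - S. real (card (R p))) / real ?q ^ c
            < exp (- 2 * (\<Sum>p\<in>{}. removed_density R p))"
          using q by simp
      qed (use fin PR in \<open>auto simp: S_def\<close>)
      moreover have "S \<union> {} \<union> (\<P> - S) = \<P>" by (auto simp: S_def)
      moreover have "(?q - 1) * (\<Sum>p\<in>S. degree p) \<le> ?q ^ Suc c"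
        using fin PR by (intro sum_degree_monic_irreducibles_le) (auto simp: S_def)
      then have "(?q - 1) * ((\<Sum>p\<in>S. degree p) + c) \<le> m + C"
        by (simp add: C_def distrib_left)
      ultimately show ?thesis unfolding m_def by metis
    next
      case True
      then obtain a where a: "a0 \<le> a" "4 * ?q ^ Suc a \<le> m" "m < 4 * ?q ^ (a + 2)"
        using ex_power_bracket[OF q] by blast
      \<comment> \<open>\<open>S1\<close> and \<open>S2\<close> go to the Chinese remainder theorem, \<open>T\<close> is sieved, \<open>L\<close> is negligible.\<close>
      define S1 where "S1 = {p\<in>\<P>. degree p \<le> a}"
      define S2 where "S2 = {p\<in>\<P> - S1. 4 * (?q - 1) * degree p \<le> card (R p)}"
      define S where "S = S1 \<union> S2"
      define T where "T = {p\<in>\<P> - S. degree p \<le> 3 * a}"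
      define L where "L = \<P> - S - T"
      have sub: "S1 \<subseteq> \<P>" "S2 \<subseteq> \<P>" "T \<subseteq> \<P>" "L \<subseteq> \<P>" "S1 \<inter> S2 = {}"
        by (auto simp: S1_def S2_def T_def L_def)
      have fins: "finite S1" "finite S2" "finite T" "finite L" using fin sub finite_subset by blast+
      have T: "a < degree p" "card (R p) < 4 * (?q - 1) * degree p" if "p \<in> T" for p
        using that by (auto simp: T_def S_def S1_def S2_def)
      have un: "S \<union> T \<union> L = \<P>" using sub by (auto simp: S_def L_def)
      let ?w = "\<Sum>p\<in>T. removed_density R p"
      have w: "0 \<le> ?w" "?w \<le> 4 * real ?q"
      proof -
        have "?w \<le> (\<Sum>p\<in>T. real (card (R p)) / real ?q ^ Suc a)"
          unfolding removed_density_def using T q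
          by (intro sum_mono divide_left_mono power_increasing) (auto simp: Suc_le_eq)
        also have "\<dots> = real (\<Sum>p\<in>T. card (R p)) / real ?q ^ Suc a"
          by (simp add: sum_divide_distrib)
        also have "\<dots> \<le> real (4 * ?q ^ (a + 2)) / real ?q ^ Suc a"
          using m_subset[OF sub(3)] a(3) by (intro divide_right_mono of_nat_mono) auto
        also have "\<dots> = 4 * real ?q" by simp
        finally show "?w \<le> 4 * real ?q" .
      qed (simp add: removed_density_def sum_nonneg)
      have "\<exists>u\<in>polys_below ((\<Sum>p\<in>S. degree p) + 3 * a * k). \<forall>p\<in>S \<union> T \<union> L. \<forall>r\<in>R p. \<not> p dvd u - r"
      proof (rule ex_avoiding_three_ranges[where k = k and J = "3 * a" and c = "3 * a"])
        show "degree p \<le> 3 * a \<and> removed_density R p \<le> 1 / 2" if "p \<in> T" for p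
        proof
          have "2 * card (R p) \<le> 2 * (4 * (?q - 1) * degree p)"
            using T[OF that] by (intro mult_le_mono2 less_imp_le)
          also have "\<dots> = 8 * (?q - 1) * degree p" by simp
          finally have "real (2 * card (R p)) \<le> real (8 * (?q - 1) * degree p)"
            by (rule of_nat_mono)
          also have "real (8 * (?q - 1) * degree p) \<le> real ?q ^ degree p"
            using T[OF that] a(1) by (intro a0(1)) auto
          finally have "2 * real (card (R p)) \<le> real ?q ^ degree p"
            by simp
          then show "removed_density R p \<le> 1 / 2"
            by (simp add: removed_density_def divide_simps)
        qed (use that in \<open>simp add: T_def\<close>)
        have "?w ^ k / fact k \<le> (4 * real ?q) ^ k / fact k"
          using w by (intro divide_right_mono power_mono) auto
        then have "?w ^ k / fact k < y" using k(2) by linarith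
        moreover have "(\<Sum>p\<in>L. real (card (R p))) / real ?q ^ (3 * a) < y"
        proof -
          have "(\<Sum>p\<in>L. real (card (R p))) / real ?q ^ (3 * a) = real (\<Sum>p\<in>L. card (R p)) / real ?q ^ (3 * a)"
            by simp
          also have "\<dots> \<le> real (4 * ?q ^ (a + 2)) / real ?q ^ (3 * a)"
            using m_subset[OF sub(4)] a(3) by (intro divide_right_mono of_nat_mono) auto
          also have "\<dots> < y" using a0(3)[OF a(1)] by simp
          finally show ?thesis .
        qed
        moreover have "y + y \<le> exp (- 2 * ?w)"
          using w by (simp add: y_def)
        ultimately show "?w ^ k / fact k + (\<Sum>p\<in>L. real (card (R p))) / real ?q ^ (3 * a) < exp (- 2 * ?w)"
          by linarith
        show "k * (3 * a) \<le> 3 * a * k" by simp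
        show "3 * a \<le> 3 * a * k" using k(1) by simp
        show "finite S" using fins by (simp add: S_def)
        show "3 * a \<le> degree p" if "p \<in> L" for p
          using that by (auto simp: L_def T_def)
        show "S \<inter> T = {}" "S \<inter> L = {}" by (auto simp: T_def L_def)
        show "monic_irreducible p" if "p \<in> S \<union> T \<union> L" for p
          using PR that un by blast
        show "R p \<subseteq> polys_below (degree p) \<and> card (R p) < ?q ^ degree p" if "p \<in> S \<union> T \<union> L" for p
          using PR that un by blast
      qed (use fins in auto)
      moreover have "(?q - 1) * ((\<Sum>p\<in>S. degree p) + 3 * a * k) \<le> m + C"
      proof -
        have "(?q - 1) * (\<Sum>p\<in>S1. degree p) \<le> ?q ^ Suc a"
          using fins PR by (intro sum_degree_monic_irreducibles_le) (auto simp: S1_def)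
        moreover have "4 * ((?q - 1) * (\<Sum>p\<in>S2. degree p)) \<le> m"
        proof -
          have "4 * ((?q - 1) * (\<Sum>p\<in>S2. degree p)) = (\<Sum>p\<in>S2. 4 * (?q - 1) * degree p)"
            by (simp add: mult.assoc flip: sum_distrib_left)
          also have "\<dots> \<le> (\<Sum>p\<in>S2. card (R p))" by (intro sum_mono) (simp add: S2_def)
          also have "\<dots> \<le> m" by (rule m_subset[OF sub(2)])
          finally show ?thesis .
        qed
        moreover have "(?q - 1) * (3 * a * k) \<le> 2 * ?q ^ Suc a"
          using a0(2)[OF a(1)] by (simp only: mult_ac)
        moreover have "(\<Sum>p\<in>S. degree p) = (\<Sum>p\<in>S1. degree p) + (\<Sum>p\<in>S2. degree p)"
          unfolding S_def by (rule sum.union_disjoint[OF fins(1,2) sub(5)])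
        ultimately show ?thesis
          using a(2) by (simp only: distrib_left)
      qed
      ultimately show ?thesis
        unfolding un m_def by blast
    qed
  qed
  show ?thesis
  proof (rule exI[of _ C], intro allI impI)
    fix \<P> :: "'a poly set" and R :: "'a poly \<Rightarrow> 'a poly set"
    assume fin: "finite \<P>"
      and PR: "\<forall>p\<in>\<P>. monic_irreducible p \<and> R p \<subseteq> polys_below (degree p) \<and> card (R p) < ?q ^ degree p"
    show "\<exists>D. (?q - 1) * D \<le> (\<Sum>p\<in>\<P>. card (R p)) + C \<and>
        (\<exists>u\<in>polys_below D. \<forall>p\<in>\<P>. \<forall>r\<in>R p. \<not> p dvd u - r)"
      by (rule main[OF fin bspec[OF PR]])
  qed
qed

section \<open>Upper bound: reduction of congruence classes to residues\<close>
lemma mult_le_power_minus_one: "(q - 1) * k \<le> q ^ k - 1" if "1 \<le> q" for q k :: nat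
proof (induction k)
  case (Suc k)
  have "1 \<le> q ^ k" using that by simp
  then have "(q - 1) * 1 \<le> (q - 1) * q ^ k" by (intro mult_le_mono2)
  then have "(q - 1) * Suc k \<le> (q ^ k - 1) + (q - 1) * q ^ k"
    using Suc by (simp only: mult_Suc_right mult_1_right)
  also have "\<dots> = q ^ Suc k - 1"
    using that \<open>1 \<le> q ^ k\<close> by (simp add: diff_mult_distrib)
  finally show ?case .
qed simp

text \<open>
  Fix an uncovered \<open>g0\<close>. For each class \<open>A = r mod f\<close> choose a prime \<open>\<pi> A\<close> and the exponent \<open>\<epsilon> A\<close> such that
  \<open>g0\<close> agrees with \<open>r\<close> modulo \<open>\<pi> A ^ \<epsilon> A\<close> but not modulo the next power, which divides \<open>f\<close>. In the tree of
  residues modulo powers of \<open>p\<close>, the class then sits inside a branch that leaves the path of \<open>g0\<close> at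
  level \<open>\<epsilon> A\<close>, where \<open>|p| - 1\<close> branches leave.

  Let \<open>v p\<close> be the first level with fewer than \<open>|p| - 1\<close> leaving classes, and let \<open>Q\<close> be the product of
  the \<open>p ^ v p\<close>. Restricting to \<open>g0 + Q u\<close> avoids all classes leaving below \<open>v p\<close>; this costs \<open>degree Q\<close>, and
  at least \<open>|p| - 1 \<ge> (q - 1) degree p\<close> classes at each of these levels pay for it. A class leaving at
  level \<open>v p\<close> forbids one residue of \<open>u\<close> modulo \<open>p\<close>, and all classes leaving later together forbid only the
  residue \<open>0\<close>. So fewer than \<open>|p|\<close> residues are forbidden, and never more than there are classes left.
\<close>
lemma uncovered_reduces_to_residue_avoidance:
  fixes \<C> :: "'a::{finite,field} poly set set"
  assumes fin: "finite \<C>" and cls: "\<And>A. A \<in> \<C> \<Longrightarrow> is_congruence_class A" and g0: "g0 \<notin> \<Union>\<C>"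
  obtains \<P> Q R where "finite \<P>"
    "\<And>p. p \<in> \<P> \<Longrightarrow> monic_irreducible p \<and> finite (R p) \<and> card (R p) < CARD('a) ^ degree p"
    "Q \<noteq> 0" "(CARD('a) - 1) * degree Q + (\<Sum>p\<in>\<P>. card (R p)) \<le> card \<C>"
    "\<And>u. (\<And>p r. p \<in> \<P> \<Longrightarrow> r \<in> R p \<Longrightarrow> \<not> p dvd u - r) \<Longrightarrow> g0 + Q * u \<notin> \<Union>\<C>"
proof -
  let ?q = "CARD('a)"
  have q: "2 \<le> ?q" by (rule card_field_ge_2)
  have "\<exists>r p i. monic_irreducible p \<and> p ^ i dvd g0 - r \<and> \<not> p ^ Suc i dvd g0 - r
      \<and> (\<forall>g\<in>A. p ^ Suc i dvd g - r)" if A: "A \<in> \<C>" for A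
  proof -
    obtain r f where f: "degree f > 0" "A = congruence_class r f"
      using cls[OF A] by (auto simp: is_congruence_class_def)
    have "f \<noteq> 0" using f by auto
    moreover have "\<not> f dvd g0 - r"
      using g0 A f by (auto simp: congruence_class_def cong_iff_dvd_diff)
    ultimately obtain p i where p: "monic_irreducible p" "p ^ i dvd g0 - r" "\<not> p ^ Suc i dvd g0 - r" "p ^ Suc i dvd f"
      using ex_prime_power_separating by blast
    moreover have "p ^ Suc i dvd g - r" if "g \<in> A" for g
      using that f p(4) by (auto simp: congruence_class_def cong_iff_dvd_diff intro: dvd_trans)
    ultimately show ?thesis by blast
  qed
  then obtain \<r> \<pi> \<epsilon> where sep: "\<And>A. A \<in> \<C> \<Longrightarrow> monic_irreducible (\<pi> A)"
    "\<And>A. A \<in> \<C> \<Longrightarrow> \<pi> A ^ \<epsilon> A dvd g0 - \<r> A" "\<And>A. A \<in> \<C> \<Longrightarrow> \<not> \<pi> A ^ Suc (\<epsilon> A) dvd g0 - \<r> A"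
    "\<And>A g. A \<in> \<C> \<Longrightarrow> g \<in> A \<Longrightarrow> \<pi> A ^ Suc (\<epsilon> A) dvd g - \<r> A"
    by metis
  define \<P> where "\<P> = \<pi> ` \<C>"
  define lvl where "lvl = (\<lambda>p i. {A \<in> \<C>. \<pi> A = p \<and> \<epsilon> A = i})"
  define high where "high = (\<lambda>p i. {A \<in> \<C>. \<pi> A = p \<and> i < \<epsilon> A})"
  define v where "v = (\<lambda>p. LEAST i. card (lvl p i) + 1 < ?q ^ degree p)"
  define Q where "Q = (\<Prod>p\<in>\<P>. p ^ v p)"
  define Q' where "Q' = (\<lambda>p. \<Prod>p'\<in>\<P> - {p}. p' ^ v p')"
  have finP: "finite \<P>" using fin by (simp add: \<P>_def)
  have finl: "finite (lvl p i)" "finite (high p i)" for p i using fin by (auto simp: lvl_def high_def)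
  have irr: "monic_irreducible p" if "p \<in> \<P>" for p using that sep(1) by (auto simp: \<P>_def)
  have v: "card (lvl p (v p)) + 1 < ?q ^ degree p" if p: "p \<in> \<P>" for p
  proof -
    obtain i where "i \<notin> \<epsilon> ` \<C>" using fin ex_new_if_finite infinite_UNIV_nat by (metis finite_imageI)
    then have "lvl p i = {}" by (auto simp: lvl_def)
    moreover have "1 < ?q ^ degree p"
      using q monic_irreducible_degree_pos[OF irr[OF p]] by (intro one_less_power) auto
    ultimately have "card (lvl p i) + 1 < ?q ^ degree p" by simp
    then show ?thesis unfolding v_def by (rule LeastI)
  qed
  have below_v: "?q ^ degree p - 1 \<le> card (lvl p i)" if "i < v p" for p i
    using not_less_Least[of i "\<lambda>i. card (lvl p i) + 1 < ?q ^ degree p"] that v_def by auto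
  have Q: "Q = p ^ v p * Q' p" if "p \<in> \<P>" for p
    unfolding Q_def Q'_def by (rule prod.remove[OF finP that])
  have Q': "\<not> p dvd Q' p" if "p \<in> \<P>" for p
    unfolding Q'_def
    using monic_irreducible_dvd_prod[OF irr[OF that], of "\<P> - {p}" "\<lambda>p. p ^ v p"]
      monic_irreducible_dvd_power irr that finP by (metis Diff_iff finite_Diff insertCI)
  have "\<exists>x. \<pi> A dvd (g0 - \<r> A) div \<pi> A ^ \<epsilon> A + Q' (\<pi> A) * x" if "A \<in> \<C>" for A
    using ex_residue_solution[OF sep(1)[OF that] Q'] that by (auto simp: \<P>_def)
  then obtain \<rho> where \<rho>: "\<And>A. A \<in> \<C> \<Longrightarrow> \<pi> A dvd (g0 - \<r> A) div \<pi> A ^ \<epsilon> A + Q' (\<pi> A) * \<rho> A"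
    by metis
  define R where "R = (\<lambda>p. \<rho> ` lvl p (v p) \<union> (if high p (v p) = {} then {} else {0}))"
  have cardR: "card (R p) \<le> card (lvl p (v p)) + card (if high p (v p) = {} then {} else {0 :: 'a poly})" for p
    unfolding R_def using card_image_le[OF finl(1), of \<rho> p "v p"]
    by (intro order_trans[OF card_Un_le] add_mono) auto
  show ?thesis
  proof (rule that[of \<P> R Q])
    show "finite \<P>" by (rule finP)
    show "monic_irreducible p \<and> finite (R p) \<and> card (R p) < ?q ^ degree p" if "p \<in> \<P>" for p
    proof (intro conjI)
      have "card (if high p (v p) = {} then {} else {0 :: 'a poly}) \<le> 1" by simp
      then show "card (R p) < ?q ^ degree p" using cardR[of p] v[OF that] by linarith
    qed (use irr[OF that] finl in \<open>auto simp: R_def\<close>)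
    show "Q \<noteq> 0"
      unfolding Q_def using finP irr monic_irreducible_nonzero by (metis (no_types, lifting) power_eq_0_iff prod_zero_iff)
    have "(?q - 1) * (v p * degree p) + card (R p) \<le> card {A \<in> \<C>. \<pi> A = p}" for p
    proof -
      have "(?q - 1) * (v p * degree p) = v p * ((?q - 1) * degree p)" by simp
      also have "\<dots> \<le> v p * (?q ^ degree p - 1)"
        using q by (intro mult_le_mono2 mult_le_power_minus_one) simp
      also have "\<dots> = (\<Sum>i<v p. ?q ^ degree p - 1)" by simp
      also have "\<dots> \<le> (\<Sum>i<v p. card (lvl p i))" using below_v by (intro sum_mono) auto
      also have "\<dots> = card (\<Union>i<v p. lvl p i)"
        using finl by (intro card_UN_disjoint[symmetric]) (auto simp: lvl_def)
      finally have 1: "(?q - 1) * (v p * degree p) \<le> card (\<Union>i<v p. lvl p i)" .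
      have "card (if high p (v p) = {} then {} else {0 :: 'a poly}) \<le> card (high p (v p))"
        using finl(2)[of p "v p"] by (simp add: Suc_le_eq card_gt_0_iff)
      then have 2: "card (R p) \<le> card (lvl p (v p)) + card (high p (v p))"
        using cardR[of p] by linarith
      have "{A \<in> \<C>. \<pi> A = p} = (\<Union>i<v p. lvl p i) \<union> (lvl p (v p) \<union> high p (v p))"
        by (auto simp: lvl_def high_def)
      also have "card \<dots> = card (\<Union>i<v p. lvl p i) + card (lvl p (v p) \<union> high p (v p))"
        using finl by (intro card_Un_disjoint) (auto simp: lvl_def high_def)
      also have "card (lvl p (v p) \<union> high p (v p)) = card (lvl p (v p)) + card (high p (v p))"
        using finl by (intro card_Un_disjoint) (auto simp: lvl_def high_def)
      finally show ?thesis using 1 2 by linarith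
    qed
    then have "(\<Sum>p\<in>\<P>. (?q - 1) * (v p * degree p) + card (R p)) \<le> (\<Sum>p\<in>\<P>. card {A \<in> \<C>. \<pi> A = p})"
      by (intro sum_mono)
    also have "\<dots> = card \<C>"
      using sum.group[OF fin finP, of \<pi> "\<lambda>_. 1 :: nat"] by (simp add: \<P>_def)
    finally have "(?q - 1) * (\<Sum>p\<in>\<P>. v p * degree p) + (\<Sum>p\<in>\<P>. card (R p)) \<le> card \<C>"
      by (simp only: sum.distrib sum_distrib_left)
    moreover have "degree Q = (\<Sum>p\<in>\<P>. v p * degree p)"
      unfolding Q_def using irr monic_irreducible_nonzero
      by (subst degree_prod_eq_sum_degree) (auto simp: degree_power_eq)
    ultimately show "(?q - 1) * degree Q + (\<Sum>p\<in>\<P>. card (R p)) \<le> card \<C>"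
      by simp
    show "g0 + Q * u \<notin> \<Union>\<C>" if u: "\<And>p r. p \<in> \<P> \<Longrightarrow> r \<in> R p \<Longrightarrow> \<not> p dvd u - r" for u
    proof
      assume "g0 + Q * u \<in> \<Union>\<C>"
      then obtain A where A: "A \<in> \<C>" "g0 + Q * u \<in> A" by blast
      define p i d where "p = \<pi> A" and "i = \<epsilon> A" and "d = g0 - \<r> A"
      have p: "p \<in> \<P>" "monic_irreducible p" "p \<noteq> 0"
        using A irr monic_irreducible_nonzero by (auto simp: p_def \<P>_def)
      have d: "p ^ i dvd d" "\<not> p ^ Suc i dvd d"
        using sep(2,3)[OF A(1)] by (simp_all add: p_def i_def d_def)
      have eq: "d + Q * u = g0 + Q * u - \<r> A" by (simp add: d_def)
      have dQ: "p ^ Suc i dvd d + Q * u"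
        unfolding eq p_def i_def by (rule sep(4)[OF A])
      note Qp = Q[OF p(1)]
      consider "i < v p" | "i = v p" | "v p < i" by linarith
      then show False
      proof cases
        case 1
        then have "p ^ Suc i dvd p ^ v p" by (intro le_imp_power_dvd) simp
        then have "p ^ Suc i dvd Q * u" unfolding Qp by (simp only: mult.assoc dvd_mult2)
        then show False using dQ d(2) by (metis dvd_add_left_iff)
      next
        case 2
        define d' where "d' = d div p ^ i"
        have d': "d = p ^ i * d'" using d(1) by (simp add: d'_def)
        have "d + Q * u = p ^ i * (d' + Q' p * u)"
          unfolding Qp d' using 2 by (simp add: distrib_left mult.assoc)
        then have "p ^ i * p dvd p ^ i * (d' + Q' p * u)"
          using dQ by (simp add: mult.commute)
        then have equ: "p dvd d' + Q' p * u" using p(3) by simp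
        have eqr: "p dvd d' + Q' p * \<rho> A"
          using \<rho>[OF A(1)] by (simp add: p_def i_def d_def d'_def)
        have "p dvd (d' + Q' p * u) - (d' + Q' p * \<rho> A)" by (rule dvd_diff[OF equ eqr])
        then have "p dvd Q' p * (u - \<rho> A)" by (simp add: right_diff_distrib)
        then have "p dvd u - \<rho> A"
          using monic_irreducible_dvd_mult_iff[OF p(2)] Q'[OF p(1)] by blast
        moreover have "\<rho> A \<in> R p"
          using A(1) 2 by (auto simp: R_def lvl_def p_def i_def)
        ultimately show False using u p(1) by blast
      next
        case 3
        then have "p ^ Suc (v p) dvd p ^ i" "p ^ Suc (v p) dvd p ^ Suc i"
          by (intro le_imp_power_dvd; simp)+
        then have "p ^ Suc (v p) dvd d" "p ^ Suc (v p) dvd d + Q * u"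
          using d(1) dQ by (blast intro: dvd_trans)+
        then have "p ^ Suc (v p) dvd Q * u" by (simp only: dvd_add_right_iff)
        then have "p ^ v p * p dvd p ^ v p * (Q' p * u)"
          unfolding Qp by (simp add: mult_ac)
        then have "p dvd Q' p * u" using p(3) by simp
        then have "p dvd u - 0"
          using monic_irreducible_dvd_mult_iff[OF p(2)] Q'[OF p(1)] by auto
        moreover have "0 \<in> R p"
          using A(1) 3 by (auto simp: R_def high_def p_def i_def)
        ultimately show False using u p(1) by blast
      qed
    qed
  qed
qed

text \<open>
  Since the forbidden residues of \<open>u\<close> may be translated, \<open>g0\<close> may be replaced by its remainder modulo
  \<open>Q\<close>; the degree of \<open>g0\<close> does not enter the bound.
\<close>
lemma ex_uncovered_below:
  "\<exists>C. \<forall>\<C> :: 'a::{finite,field} poly set set.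
     finite \<C> \<longrightarrow> (\<forall>A\<in>\<C>. is_congruence_class A) \<longrightarrow> \<Union>\<C> \<noteq> UNIV \<longrightarrow>
     (\<exists>D. (CARD('a) - 1) * D \<le> card \<C> + C \<and> (\<exists>g\<in>polys_below D. g \<notin> \<Union>\<C>))"
proof -
  let ?q = "CARD('a)"
  obtain C where C: "\<forall>(\<P> :: 'a poly set) R.
     finite \<P> \<longrightarrow> (\<forall>p\<in>\<P>. monic_irreducible p \<and> R p \<subseteq> polys_below (degree p) \<and> card (R p) < ?q ^ degree p)
     \<longrightarrow> (\<exists>D. (?q - 1) * D \<le> (\<Sum>p\<in>\<P>. card (R p)) + C \<and>
           (\<exists>u\<in>polys_below D. \<forall>p\<in>\<P>. \<forall>r\<in>R p. \<not> p dvd u - r))"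
    by (rule exE[OF ex_avoiding_below_sum_of_residues[where 'a='a]])
  show ?thesis
  proof (rule exI[of _ C], intro allI impI)
    fix \<C> :: "'a poly set set"
    assume fin: "finite \<C>" and cls: "\<forall>A\<in>\<C>. is_congruence_class A" and "\<Union>\<C> \<noteq> UNIV"
    then obtain g0 where g0: "g0 \<notin> \<Union>\<C>" by blast
    obtain \<P> Q R where red: "finite \<P>"
      "\<And>p. p \<in> \<P> \<Longrightarrow> monic_irreducible p \<and> finite (R p) \<and> card (R p) < ?q ^ degree p"
      "Q \<noteq> 0" "(?q - 1) * degree Q + (\<Sum>p\<in>\<P>. card (R p)) \<le> card \<C>"
      "\<And>u. (\<And>p r. p \<in> \<P> \<Longrightarrow> r \<in> R p \<Longrightarrow> \<not> p dvd u - r) \<Longrightarrow> g0 + Q * u \<notin> \<Union>\<C>"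
      using uncovered_reduces_to_residue_avoidance[OF fin bspec[OF cls] g0] by metis
    \<comment> \<open>With \<open>u - k\<close> in place of \<open>u\<close>, the polynomial \<open>g0 + Q u\<close> becomes \<open>g0 mod Q + Q u\<close>.\<close>
    define k where "k = g0 div Q"
    define R' where "R' = (\<lambda>p. (\<lambda>r. (r + k) mod p) ` R p)"
    have cardR': "card (R' p) \<le> card (R p)" if "p \<in> \<P>" for p
      unfolding R'_def using red(2)[OF that] by (intro card_image_le) simp
    have R'ok: "\<forall>p\<in>\<P>. monic_irreducible p \<and> R' p \<subseteq> polys_below (degree p) \<and> card (R' p) < ?q ^ degree p"
    proof (intro ballI conjI)
      fix p assume p: "p \<in> \<P>"
      show "monic_irreducible p" using red(2)[OF p] by simp
      then show "R' p \<subseteq> polys_below (degree p)"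
        using mod_in_polys_below[OF monic_irreducible_nonzero] by (auto simp: R'_def)
      show "card (R' p) < ?q ^ degree p" using red(2)[OF p] cardR'[OF p] by linarith
    qed
    obtain D u where D: "(?q - 1) * D \<le> (\<Sum>p\<in>\<P>. card (R' p)) + C"
      and u: "u \<in> polys_below D" "\<forall>p\<in>\<P>. \<forall>r\<in>R' p. \<not> p dvd u - r"
      using C[THEN spec, THEN spec, THEN mp, OF red(1), THEN mp, OF R'ok] by blast
    have "g0 + Q * (u - k) \<notin> \<Union>\<C>"
    proof (rule red(5))
      fix p r assume p: "p \<in> \<P>" and r: "r \<in> R p"
      have "\<not> p dvd u - (r + k) mod p" using u(2) p r by (auto simp: R'_def)
      moreover have "u - (r + k) mod p = (u - k - r) + ((r + k) - (r + k) mod p)" by simp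
      moreover have "p dvd (r + k) - (r + k) mod p" by (rule dvd_minus_mod)
      ultimately show "\<not> p dvd u - k - r" by (metis dvd_add)
    qed
    moreover have "g0 + Q * (u - k) = g0 mod Q + Q * u"
      using div_mult_mod_eq[of g0 Q] by (simp add: k_def algebra_simps)
    moreover have "g0 mod Q + Q * u \<in> polys_below (degree Q + D)"
      using mod_in_polys_below[OF red(3), of g0] polys_below_mono[of "degree Q" "degree Q + D"]
        mult_in_polys_below_iff[OF red(3), of u D] u(1) by (intro polys_below_add) auto
    moreover have "(?q - 1) * (degree Q + D) \<le> card \<C> + C"
    proof -
      have "(\<Sum>p\<in>\<P>. card (R' p)) \<le> (\<Sum>p\<in>\<P>. card (R p))" using cardR' by (intro sum_mono)
      then show ?thesis using D red(4) by (simp only: distrib_left)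
    qed
    ultimately show "\<exists>D. (?q - 1) * D \<le> card \<C> + C \<and> (\<exists>g\<in>polys_below D. g \<notin> \<Union>\<C>)"
      by metis
  qed
qed

section \<open>Lower bound: separating valuations at zero\<close>
lemma exact_valuation_class:
  "congruence_class (monom a i) (monom 1 (Suc i)) = {g. (\<forall>j<i. coeff g j = 0) \<and> coeff g i = a}"
  for a :: "'a::field"
  by (auto simp: congruence_class_def cong_iff_dvd_diff monom_1_dvd_iff' less_Suc_eq)

lemma divisible_class:
  "congruence_class 0 (monom 1 k) = {g :: 'a::field poly. \<forall>j<k. coeff g j = 0}"
  by (auto simp: congruence_class_def cong_iff_dvd_diff monom_1_dvd_iff')

text \<open>
  The \<open>m (q - 1)\<close> classes of polynomials with valuation \<open>i < m\<close> and given coefficient \<open>a \<noteq> 0\<close> at \<open>x^i\<close>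
  cover all nonzero polynomials of degree below \<open>m\<close>. The other classes, the multiples of
  \<open>x^(m+1), x^(m+2), \<dots>\<close>, cover \<open>0\<close> and bring the number up to exactly \<open>n\<close>. None of them contains \<open>x^m\<close>.
\<close>
lemma ex_family_covering_below:
  fixes m n :: nat
  assumes "m * (CARD('a::{finite,field}) - 1) < n"
  obtains \<C> :: "'a::{finite,field} poly set set" where "\<C> \<in> non_covering_families n" "polys_below m \<subseteq> \<Union>\<C>"
proof -
  define V :: "nat \<times> 'a \<Rightarrow> 'a poly set" where "V = (\<lambda>(i, a). {g. (\<forall>j<i. coeff g j = 0) \<and> coeff g i = a})"
  define Z :: "nat \<Rightarrow> 'a poly set" where "Z = (\<lambda>k. {g. \<forall>j<k. coeff g j = 0})"
  define I :: "(nat \<times> 'a) set" where "I = {..<m} \<times> (UNIV - {0})"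
  define K where "K = {Suc m..<Suc m + (n - m * (CARD('a) - 1))}"
  have mV: "monom a i \<in> V (i, a)" for a i by (simp add: V_def)
  have mZ: "monom 1 k \<in> Z k'" if "k' \<le> k" for k k' using that by (simp add: Z_def)
  have "inj_on V I"
  proof (rule inj_onI)
    fix x y assume x: "x \<in> I" and y: "y \<in> I" and eq: "V x = V y"
    obtain i a j b where xy: "x = (i, a)" "y = (j, b)" by fastforce
    have "monom a i \<in> V (j, b)" using eq mV xy by metis
    then have "coeff (monom a i) j = b" by (simp add: V_def)
    moreover have "b \<noteq> 0" using y by (auto simp: xy I_def)
    ultimately show "x = y" by (simp add: xy split: if_splits)
  qed
  then have cardV: "card (V ` I) = m * (CARD('a) - 1)"
    by (simp add: card_image I_def card_cartesian_product)
  have "inj Z"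
  proof (rule linorder_injI)
    fix k k' :: nat assume "k < k'"
    then have "monom 1 k \<notin> Z k'" unfolding Z_def by (intro notI) (auto dest!: spec[of _ k])
    then show "Z k \<noteq> Z k'" using mZ[of k k] by auto
  qed
  then have cardZ: "card (Z ` K) = n - m * (CARD('a) - 1)"
    by (simp add: card_image[OF inj_on_subset[of Z UNIV]] K_def)
  have disj: "V ` I \<inter> Z ` K = {}"
  proof (rule equals0I)
    fix A assume A: "A \<in> V ` I \<inter> Z ` K"
    then have "0 \<in> A" by (auto simp: Z_def)
    moreover have "0 \<notin> A" using A by (auto simp: V_def I_def)
    ultimately show False by blast
  qed
  have fin: "finite (V ` I)" "finite (Z ` K)" by (simp_all add: I_def K_def)
  have "is_congruence_class A" if A: "A \<in> V ` I \<union> Z ` K" for A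
  proof -
    have "0 < k" if "k \<in> K" for k using that by (simp add: K_def)
    then consider x where "A = V x" | k where "0 < k" "A = Z k"
      using A by blast
    then obtain r k where "0 < k" "A = congruence_class r (monom 1 k)"
    proof cases
      case (1 x)
      obtain i a where "x = (i, a)" by (cases x)
      then show ?thesis using 1 that[of "Suc i" "monom a i"] by (simp add: V_def exact_valuation_class)
    next
      case (2 k)
      then show ?thesis using that[of k 0] by (simp add: Z_def divisible_class)
    qed
    then show ?thesis
      unfolding is_congruence_class_def
      by (intro exI[of _ r] exI[of _ "monom 1 k"]) (simp add: degree_monom_eq)
  qed
  moreover have "monom 1 m \<notin> \<Union>(V ` I \<union> Z ` K)"
    by (auto simp: V_def Z_def I_def K_def dest!: spec[of _ m])
  moreover have "card (V ` I \<union> Z ` K) = n"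
    using card_Un_disjoint[OF fin disj] cardV cardZ assms by simp
  ultimately have "V ` I \<union> Z ` K \<in> non_covering_families n"
    using fin unfolding non_covering_families_def by auto
  moreover have "g \<in> \<Union>(V ` I \<union> Z ` K)" if g: "g \<in> polys_below m" for g
  proof (cases "g = 0")
    case True
    then have "g \<in> Z (Suc m)" by (simp add: Z_def)
    moreover have "Suc m \<in> K" using assms by (simp add: K_def)
    ultimately show ?thesis by blast
  next
    case False
    define i where "i = (LEAST i. coeff g i \<noteq> 0)"
    have nz: "coeff g i \<noteq> 0"
      unfolding i_def using LeastI[of "\<lambda>i. coeff g i \<noteq> 0" "degree g"] False by simp
    have "coeff g j = 0" if "j < i" for j
      using not_less_Least[of j "\<lambda>i. coeff g i \<noteq> 0"] that by (simp add: i_def)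
    moreover have "i < m"
    proof (rule ccontr)
      assume "\<not> i < m"
      then have "coeff g i = 0" using g by (simp add: polys_below_def)
      then show False using nz by simp
    qed
    ultimately have "g \<in> V (i, coeff g i)" "(i, coeff g i) \<in> I"
      using nz by (simp_all add: V_def I_def)
    then show ?thesis by blast
  qed
  ultimately show ?thesis using that by blast
qed

section \<open>The growth of the extremal degree\<close>
lemma deg_le_if_in_polys_below: "g \<in> polys_below D \<Longrightarrow> deg g \<le> ereal (real D)"
  by (auto simp: deg_def polys_below_iff)

lemma deg_ge_if_notin_polys_below: "g \<notin> polys_below m \<Longrightarrow> ereal (real m) \<le> deg g"
  by (auto simp: deg_def polys_below_iff)

lemma Dq_bounds:
  fixes F :: "'a::{finite,field} itself"
  defines "q \<equiv> CARD('a)"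
  obtains C where "\<And>n. 1 \<le> n \<Longrightarrow> finite (Dq_values F n) \<and> Dq_values F n \<noteq> {} \<and>
    ereal (real ((n - 1) div (q - 1))) \<le> Dq F n \<and> Dq F n \<le> ereal (real ((n + C) div (q - 1)))"
proof -
  have q: "0 < q - 1" using card_field_ge_2[where 'a='a] by (simp add: q_def)
  obtain C where C: "\<forall>\<C> :: 'a poly set set.
     finite \<C> \<longrightarrow> (\<forall>A\<in>\<C>. is_congruence_class A) \<longrightarrow> \<Union>\<C> \<noteq> UNIV \<longrightarrow>
     (\<exists>D. (CARD('a) - 1) * D \<le> card \<C> + C \<and> (\<exists>g\<in>polys_below D. g \<notin> \<Union>\<C>))"
    by (rule exE[OF ex_uncovered_below[where 'a='a]])
  have "finite (Dq_values F n) \<and> Dq_values F n \<noteq> {} \<and>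
    ereal (real ((n - 1) div (q - 1))) \<le> Dq F n \<and> Dq F n \<le> ereal (real ((n + C) div (q - 1)))"
    if n: "1 \<le> n" for n
  proof -
    let ?N = "(n + C) div (q - 1)" and ?m = "(n - 1) div (q - 1)"
    have up: "d \<in> insert (-\<infinity>) ((\<lambda>k. ereal (real k)) ` {..?N})" if "d \<in> Dq_values F n" for d
    proof -
      obtain \<C> :: "'a poly set set" where \<C>: "\<C> \<in> non_covering_families n" "d = min_uncovered_deg \<C>"
        using \<open>d \<in> Dq_values F n\<close> by (auto simp: Dq_values_def)
      have fam: "finite \<C>" "card \<C> = n" "\<forall>A\<in>\<C>. is_congruence_class A" "\<Union>\<C> \<noteq> UNIV"
        using \<C>(1) by (auto simp: non_covering_families_def)
      obtain D g where D: "(q - 1) * D \<le> n + C" "g \<in> polys_below D" "g \<notin> \<Union>\<C>"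
        using C[rule_format, OF fam(1) _ fam(4)] fam(2,3) unfolding q_def by blast
      have "D \<le> ?N" using D(1) q by (simp add: less_eq_div_iff_mult_less_eq mult.commute)
      have "d \<le> deg g" unfolding \<C>(2) by (rule min_uncovered_deg(2)[OF fam(4) D(3)])
      also have "\<dots> \<le> ereal (real D)" by (rule deg_le_if_in_polys_below[OF D(2)])
      also have "\<dots> \<le> ereal (real ?N)" using \<open>D \<le> ?N\<close> by simp
      finally have "d \<le> ereal (real ?N)" .
      moreover obtain g' :: "'a poly" where "d = deg g'" using min_uncovered_deg(1)[OF fam(4)] \<C>(2) by blast
      ultimately show ?thesis by (auto simp: deg_def split: if_splits)
    qed
    then have fin: "finite (Dq_values F n)"
      by (meson finite.insertI finite_atMost finite_imageI finite_subset subsetI)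
    have "?m * (q - 1) \<le> n - 1" by (rule div_times_less_eq_dividend)
    then have "?m * (q - 1) < n" using n by linarith
    then obtain \<C> :: "'a poly set set" where \<C>: "\<C> \<in> non_covering_families n" "polys_below ?m \<subseteq> \<Union>\<C>"
      using ex_family_covering_below[where 'a='a] unfolding q_def by blast
    then obtain g where g: "g \<notin> \<Union>\<C>" "min_uncovered_deg \<C> = deg g"
      using min_uncovered_deg(1)[of \<C>] by (auto simp: non_covering_families_def)
    have val: "deg g \<in> Dq_values F n" using \<C>(1) g(2) by (force simp: Dq_values_def)
    have "ereal (real ?m) \<le> deg g" using g(1) \<C>(2) by (intro deg_ge_if_notin_polys_below) blast
    also have "\<dots> \<le> Dq F n" unfolding Dq_def using fin val by (rule Max_ge)
    finally have "ereal (real ?m) \<le> Dq F n" .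
    moreover have "Dq F n \<in> Dq_values F n" unfolding Dq_def using fin val by (intro Max_in) auto
    then have "Dq F n \<le> ereal (real ?N)" using up[of "Dq F n"] by auto
    ultimately show ?thesis using fin val by blast
  qed
  then show ?thesis using that by blast
qed

theorem theorem5:
  fixes F :: "'a::{finite, field} itself" and q :: nat
  assumes "q = CARD('a)"
  shows
    "(\<forall>n\<ge>1. finite (Dq_values F n) \<and> Dq_values F n \<noteq> {}) \<and>
     (\<exists>C::real. \<forall>n\<ge>1.
        ereal (real_of_int \<lfloor>(real n - 1) / (real q - 1)\<rfloor>) \<le> Dq F n \<and>
        Dq F n \<le> ereal (real_of_int \<lceil>real n / (real q - 1)\<rceil> + C - 1)) \<and>
     (\<exists>K::real. \<forall>n\<ge>1. \<bar>Dq F n - ereal (real n / (real q - 1))\<bar> \<le> ereal K) \<and>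
     (\<lambda>n. real_of_ereal (Dq F n)) \<sim>[at_top] (\<lambda>n. real n / (real q - 1))"
proof -
  have "2 \<le> q" unfolding assms by (rule card_field_ge_2)
  then have q: "0 < real q - 1" "1 \<le> real q - 1" "real (q - 1) = real q - 1" by auto
  obtain C where C: "\<And>n. 1 \<le> n \<Longrightarrow> finite (Dq_values F n) \<and> Dq_values F n \<noteq> {} \<and>
    ereal (real ((n - 1) div (q - 1))) \<le> Dq F n \<and> Dq F n \<le> ereal (real ((n + C) div (q - 1)))"
    using Dq_bounds[of F] unfolding assms by blast
  define x where "x = (\<lambda>n. real_of_ereal (Dq F n))"
  have "\<exists>r. Dq F n = ereal r" if "1 \<le> n" for n
    using C[OF that] by (cases "Dq F n") auto
  then have x: "Dq F n = ereal (x n)" if "1 \<le> n" for n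
    using that by (force simp: x_def)
  have lower: "real_of_int \<lfloor>(real n - 1) / (real q - 1)\<rfloor> \<le> x n" if n: "1 \<le> n" for n
  proof -
    have "\<lfloor>real (n - 1) / real (q - 1)\<rfloor> = int ((n - 1) div (q - 1))"
      by (rule floor_divide_of_nat_eq)
    then have "real_of_int \<lfloor>(real n - 1) / (real q - 1)\<rfloor> = real ((n - 1) div (q - 1))"
      using n q by (simp add: of_nat_diff)
    then show ?thesis using C[OF n] x[OF n] by simp
  qed
  have upper: "x n \<le> real n / (real q - 1) + real C" if n: "1 \<le> n" for n
  proof -
    have "x n \<le> real ((n + C) div (q - 1))" using C[OF n] x[OF n] by simp
    also have "\<dots> \<le> real (n + C) / real (q - 1)" by (rule of_nat_div_le_of_nat)
    also have "\<dots> = real n / (real q - 1) + real C / (real q - 1)"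
      by (simp only: q(3) of_nat_add add_divide_distrib)
    also have "real C / (real q - 1) \<le> real C" 
      using divide_left_mono[OF q(2), of "real C"] q(1) by simp
    finally show ?thesis by simp
  qed
  have close: "\<bar>x n - real n / (real q - 1)\<bar> \<le> real C + 2" if n: "1 \<le> n" for n
  proof -
    have "(real n - 1) / (real q - 1) - 1 \<le> real_of_int \<lfloor>(real n - 1) / (real q - 1)\<rfloor>"
      by linarith
    moreover have "(real n - 1) / (real q - 1) = real n / (real q - 1) - 1 / (real q - 1)"
      by (simp add: diff_divide_distrib)
    moreover have "1 / (real q - 1) \<le> 1" using q by simp
    ultimately show ?thesis using lower[OF n] upper[OF n] by linarith
  qed
  have "x \<sim>[at_top] (\<lambda>n. real n / (real q - 1))"
  proof (rule smallo_imp_asymp_equiv)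
    have "(\<lambda>n. x n - real n / (real q - 1)) \<in> O(\<lambda>_. 1)"
      by (rule bigoI[where c = "real C + 2"], rule eventually_mono[OF eventually_ge_at_top[of "1::nat"]])
        (use close in simp)
    also have "(\<lambda>_. 1) \<in> o(\<lambda>n. real n / (real q - 1))"
    proof (rule smalloI_tendsto)
      show "((\<lambda>n. 1 / (real n / (real q - 1))) \<longlongrightarrow> 0) sequentially"
        using tendsto_mult_right_zero[OF lim_1_over_n, of "real q - 1"] by simp
      show "\<forall>\<^sub>F n in sequentially. real n / (real q - 1) \<noteq> 0"
        using eventually_gt_at_top[of "0::nat"] q by (auto elim!: eventually_mono)
    qed
    finally show "(\<lambda>n. x n - real n / (real q - 1)) \<in> o(\<lambda>n. real n / (real q - 1))" .
  qed
  moreover have "\<exists>C::real. \<forall>n\<ge>1.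
      ereal (real_of_int \<lfloor>(real n - 1) / (real q - 1)\<rfloor>) \<le> Dq F n \<and>
      Dq F n \<le> ereal (real_of_int \<lceil>real n / (real q - 1)\<rceil> + C - 1)"
  proof (intro exI[of _ "real C + 1"] allI impI conjI)
    fix n :: nat assume n: "1 \<le> n"
    show "ereal (real_of_int \<lfloor>(real n - 1) / (real q - 1)\<rfloor>) \<le> Dq F n"
      using lower[OF n] x[OF n] by simp
    have "real n / (real q - 1) \<le> real_of_int \<lceil>real n / (real q - 1)\<rceil>" by (rule le_of_int_ceiling)
    then have "x n \<le> real_of_int \<lceil>real n / (real q - 1)\<rceil> + (real C + 1) - 1"
      using upper[OF n] by linarith
    then show "Dq F n \<le> ereal (real_of_int \<lceil>real n / (real q - 1)\<rceil> + (real C + 1) - 1)"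
      using x[OF n] by simp
  qed
  moreover have "\<exists>K::real. \<forall>n\<ge>1. \<bar>Dq F n - ereal (real n / (real q - 1))\<bar> \<le> ereal K"
    using close x by (intro exI[of _ "real C + 2"]) simp
  moreover have "\<forall>n\<ge>1. finite (Dq_values F n) \<and> Dq_values F n \<noteq> {}"
    using C by blast
  ultimately show ?thesis
    unfolding x_def by blast
qed

end
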